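(* Let $P=(\{1,2\},\{\{1,1,2,2\}\})$ and let $\mathcal{F}$ be a family of $4$-graphs such that $(\mathcal{F},P)$ is a Turán pair and $\mathcal{F}$ is degree-stable with respect to $\mathrm{Col}(P)$. Then for any $\alpha>1$ there exists $n_{0}$ such that if $G$ is an $\mathcal{F}$-free $4$-graph on $n>n_{0}$ vertices, then $\lambda_{\alpha}(G)\leq\lambda_{\alpha}(B_{4}(n))$, with equality if and only if $G=B_{4}(n)$.
   Context: A $k$-graph is a hypergraph whose edges all have $k$ vertices; $\mathcal{F}$-free means containing no member of $\mathcal{F}$ as a sub-hypergraph; $\delta(H)$ is the minimum degree. $\pi(\mathcal{F})=\lim_{n\to\infty}\mathrm{ex}(n,\mathcal{F})/\binom{n}{k}$. A $k$-pattern is $P=([l],E)$ with $E$ a collection of $k$-multisets from $[l]$; a $k$-graph $H$ is $P$-colorable if there is $\phi:V(H)\to[l]$ with $\{\phi(v_1),\dots,\phi(v_k)\}\in E$ for every edge $\{v_1,\dots,v_k\}$; $\mathrm{Col}(P)$ is the set of $P$-colorable $k$-graphs. For $P=(\{1,2\},\{\{1,1,2,2\}\})$, $P$-colorable $4$-graphs are exactly the bipartite-like ones: vertex set has a bipartition with each edge containing exactly two vertices in each part. $(\mathcal{F},P)$ is a Turán pair if every $P$-colorable $k$-graph is $\mathcal{F}$-free and every edge-maximum $\mathcal{F}$-free $k$-graph is $P$-colorable. For $\pi(\mathcal{F})>0$ and a family $\mathfrak{H}$ of $\mathcal{F}$-free $k$-graphs, $\mathcal{F}$ is degree-stable with respect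 to $\mathfrak{H}$ if there exist $\varepsilon>0$, $n_0$ such that every $\mathcal{F}$-free $k$-graph $H$ on $n\geq n_0$ vertices with $\delta(H)\geq(\pi(\mathcal{F})/(k-1)!-\varepsilon)n^{k-1}$ lies in $\mathfrak{H}$. $B_4(n)$ is the $4$-graph on $n$ vertices with parts of sizes $\lfloor n/2\rfloor,\lceil n/2\rceil$ whose edges are all $4$-sets with exactly two vertices in each part. For $\alpha>1$, $\lambda_\alpha(G)=\max\{4!\sum_{\{i_1,\dots,i_4\}\in E(G)}x_{i_1}\cdots x_{i_4}:\ \sum_i|x_i|^\alpha=1\}$. *)

theory Defs
  imports "HOL-Analysis.Analysis" "HOL-Library.Multiset"
begin

type_synonym 'a hypergraph = "'a set \<times> 'a set set"

abbreviation verts :: "'a hypergraph \<Rightarrow> 'a set" where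
  "verts H \<equiv> fst H"

abbreviation edges :: "'a hypergraph \<Rightarrow> 'a set set" where
  "edges H \<equiv> snd H"

definition kgraph :: "nat \<Rightarrow> 'a hypergraph \<Rightarrow> bool" where
  "kgraph k H \<longleftrightarrow> finite (verts H) \<and> (\<forall>e\<in>edges H. e \<subseteq> verts H \<and> card e = k)"

definition hiso :: "'a hypergraph \<Rightarrow> 'b hypergraph \<Rightarrow> bool" where
  "hiso G H \<longleftrightarrow> (\<exists>f. bij_betw f (verts G) (verts H) \<and> (\<lambda>e. f ` e) ` edges G = edges H)"

text \<open>Containment is as a not necessarily induced sub-hypergraph, up to isomorphism.\<close>

definition contains :: "'a hypergraph \<Rightarrow> 'b hypergraph \<Rightarrow> bool" where
  "contains H F \<longleftrightarrow>
     (\<exists>f. inj_on f (verts F) \<and> f ` verts F \<subseteq> verts H \<and> (\<forall>e\<in>edges F. f ` e \<in> edges H))"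

definition free_of :: "'b hypergraph set \<Rightarrow> 'a hypergraph \<Rightarrow> bool" where
  "free_of \<F> H \<longleftrightarrow> (\<forall>F\<in>\<F>. \<not> contains H F)"

definition degree :: "'a hypergraph \<Rightarrow> 'a \<Rightarrow> nat" where
  "degree H v = card {e \<in> edges H. v \<in> e}"

definition min_degree :: "'a hypergraph \<Rightarrow> nat" where
  "min_degree H = Min (degree H ` verts H)"

text \<open>
  In the following notions the hypergraphs range over vertex sets that are finite sets of natural
  numbers; every finite hypergraph is isomorphic to such a one.
\<close>

definition turan_ex :: "nat \<Rightarrow> nat hypergraph set \<Rightarrow> nat \<Rightarrow> nat" where
  "turan_ex k \<F> n =
     Max {card (edges H) | H :: nat hypergraph.
            kgraph k H \<and> free_of \<F> H \<and> card (verts H) = n}"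

definition turan_density :: "nat \<Rightarrow> nat hypergraph set \<Rightarrow> real" where
  "turan_density k \<F> = lim (\<lambda>n. real (turan_ex k \<F> n) / real (n choose k))"

text \<open>A pair \<open>(l, E)\<close> stands for the pattern on \<open>{1..l}\<close> with set of edges \<open>E\<close>.\<close>

type_synonym pattern = "nat \<times> nat multiset set"

definition kpattern :: "nat \<Rightarrow> pattern \<Rightarrow> bool" where
  "kpattern k P \<longleftrightarrow> (\<forall>M\<in>snd P. size M = k \<and> set_mset M \<subseteq> {1..fst P})"

definition colorable :: "pattern \<Rightarrow> 'a hypergraph \<Rightarrow> bool" where
  "colorable P H \<longleftrightarrow>
     (\<exists>\<phi>. \<phi> ` verts H \<subseteq> {1..fst P} \<and> (\<forall>e\<in>edges H. image_mset \<phi> (mset_set e) \<in> snd P))"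

definition Col :: "nat \<Rightarrow> pattern \<Rightarrow> nat hypergraph set" where
  "Col k P = {H. kgraph k H \<and> colorable P H}"

definition turan_pair :: "nat \<Rightarrow> nat hypergraph set \<Rightarrow> pattern \<Rightarrow> bool" where
  "turan_pair k \<F> P \<longleftrightarrow>
     (\<forall>H :: nat hypergraph. kgraph k H \<and> colorable P H \<longrightarrow> free_of \<F> H) \<and>
     (\<forall>H :: nat hypergraph. kgraph k H \<and> free_of \<F> H \<and>
         card (edges H) = turan_ex k \<F> (card (verts H)) \<longrightarrow> colorable P H)"

definition degree_stable :: "nat \<Rightarrow> nat hypergraph set \<Rightarrow> nat hypergraph set \<Rightarrow> bool" where
  "degree_stable k \<F> \<HH> \<longleftrightarrow>
     turan_density k \<F> > 0 \<and>
     (\<forall>H\<in>\<HH>. kgraph k H \<and> free_of \<F> H) \<and>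
     (\<exists>\<epsilon>>0. \<exists>n\<^sub>0. \<forall>n\<ge>n\<^sub>0. \<forall>H :: nat hypergraph.
        kgraph k H \<and> free_of \<F> H \<and> card (verts H) = n \<and>
        real (min_degree H) \<ge> (turan_density k \<F> / fact (k - 1) - \<epsilon>) * real n ^ (k - 1)
        \<longrightarrow> H \<in> \<HH>)"

definition pattern22 :: pattern where
  "pattern22 = (2, {{#1, 1, 2, 2#}})"

lemma kpattern_pattern22: "kpattern 4 pattern22"
  by (simp add: kpattern_def pattern22_def)

definition B4 :: "nat \<Rightarrow> nat hypergraph" where
  "B4 n = ({..<n},
     {e. e \<subseteq> {..<n} \<and> card (e \<inter> {..<n div 2}) = 2 \<and> card (e \<inter> {n div 2..<n}) = 2})"

definition lagr :: "nat \<Rightarrow> 'a hypergraph \<Rightarrow> ('a \<Rightarrow> real) \<Rightarrow> real" where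
  "lagr k H x = fact k * (\<Sum>e\<in>edges H. \<Prod>v\<in>e. x v)"

definition lambda_spec :: "nat \<Rightarrow> real \<Rightarrow> 'a hypergraph \<Rightarrow> real" where
  "lambda_spec k \<alpha> H = Sup {lagr k H x | x. (\<Sum>v\<in>verts H. \<bar>x v\<bar> powr \<alpha>) = 1}"

text \<open>The supremum is a maximum.\<close>

lemma lambda_spec_attained:
  fixes H :: "'a hypergraph"
  assumes H: "kgraph k H" and ne: "verts H \<noteq> {}" and \<alpha>: "\<alpha> > 0"
  shows "\<exists>x. (\<Sum>v\<in>verts H. \<bar>x v\<bar> powr \<alpha>) = 1 \<and> lagr k H x = lambda_spec k \<alpha> H \<and>
             (\<forall>y. (\<Sum>v\<in>verts H. \<bar>y v\<bar> powr \<alpha>) = 1 \<longrightarrow> lagr k H y \<le> lagr k H x)"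
proof -
  let ?V = "verts H"
  let ?s = "\<lambda>x. (\<Sum>v\<in>?V. \<bar>x v\<bar> powr \<alpha>)"
  define B :: "'a \<Rightarrow> real set" where "B v = (if v \<in> ?V then {-1..1} else {0})" for v
  define K where "K = PiE UNIV B"
  have fin: "finite ?V" and sub: "\<And>e. e \<in> edges H \<Longrightarrow> e \<subseteq> ?V"
    using H by (auto simp: kgraph_def)
  have "compactin (product_topology (\<lambda>_. euclidean) UNIV) K"
    unfolding K_def compactin_PiE by (auto simp: B_def)
  then have "compact K"
    by (simp add: euclidean_product_topology)
  have cs: "continuous_on UNIV ?s"
    by (intro continuous_on_sum continuous_on_powr' continuous_on_rabs continuous_on_const
        continuous_on_product_coordinates) (use \<alpha> in auto)
  have cl: "continuous_on UNIV (lagr k H)"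
    unfolding lagr_def
    by (intro continuous_on_mult continuous_on_sum continuous_on_prod continuous_on_const
        continuous_on_product_coordinates)
  have "closed {x. ?s x = 1}"
    by (intro closed_Collect_eq cs continuous_on_const)
  with \<open>compact K\<close> have comp: "compact (K \<inter> {x. ?s x = 1})"
    by (rule compact_Int_closed)
  obtain w where w: "w \<in> ?V" using ne by blast
  define z :: "'a \<Rightarrow> real" where "z v = (if v = w then 1 else 0)" for v
  have "?s z = (\<Sum>v\<in>?V. if v = w then 1 else 0)"
    using \<alpha> by (intro sum.cong) (auto simp: z_def)
  also have "\<dots> = 1" using fin w by simp
  finally have "z \<in> K \<inter> {x. ?s x = 1}"
    using w by (auto simp: K_def B_def z_def)
  then obtain x where x: "x \<in> K \<inter> {x. ?s x = 1}"
    and mx: "\<And>y. y \<in> K \<inter> {x. ?s x = 1} \<Longrightarrow> lagr k H y \<le> lagr k H x"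
    using continuous_attains_sup[OF comp _ continuous_on_subset[OF cl subset_UNIV]] by blast
  have mx': "lagr k H y \<le> lagr k H x" if y: "?s y = 1" for y
  proof -
    define y' where "y' v = (if v \<in> ?V then y v else 0)" for v
    have "?s y' = 1" using y by (simp add: y'_def)
    moreover have "\<bar>y v\<bar> \<le> 1" if v: "v \<in> ?V" for v
    proof (rule ccontr)
      assume "\<not> \<bar>y v\<bar> \<le> 1"
      then have "1 < \<bar>y v\<bar> powr \<alpha>" using \<alpha> by (simp add: gr_one_powr)
      also have "\<dots> \<le> ?s y" by (rule member_le_sum) (use v fin in auto)
      finally show False using y by simp
    qed
    then have "y' \<in> K" by (auto simp: K_def B_def y'_def abs_le_iff minus_le_iff)
    moreover have "lagr k H y' = lagr k H y"
    proof -
      have "(\<Prod>v\<in>e. y' v) = (\<Prod>v\<in>e. y v)" if "e \<in> edges H" for e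
        using sub[OF that] by (intro prod.cong) (auto simp: y'_def)
      then show ?thesis by (simp add: lagr_def)
    qed
    ultimately show ?thesis using mx[of y'] by simp
  qed
  have "lambda_spec k \<alpha> H = lagr k H x"
    unfolding lambda_spec_def by (rule cSup_eq_maximum) (use x mx' in auto)
  then show ?thesis using x mx' by auto
qed

end

theory Submission
  imports Defs "HOL-Real_Asymp.Real_Asymp"
begin

text \<open>
  Let \<open>\<tau> = 4 / \<alpha>\<close> and let \<open>G\<close> be \<open>\<F>\<close>-free on \<open>n\<close> vertices with
  \<open>\<lambda>\<^sub>\<alpha>(G) \<ge> \<lambda>\<^sub>\<alpha>(B\<^sub>4(n))\<close>. Among all nonempty vertex sets \<open>W\<close>, choose one that maximises
  \<open>\<lambda>\<^sub>\<alpha>(G[W]) |W|\<^sup>-\<^sup>s\<close>, where \<open>s\<close> is slightly smaller than \<open>4 - \<tau>\<close>, the growth exponent of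
  \<open>\<lambda>\<^sub>\<alpha>(B\<^sub>4(n))\<close>. As \<open>\<lambda>\<^sub>\<alpha>(G[W]) = O(|W|\<^bsup>4 - \<tau>\<^esup>)\<close>, the set \<open>W\<close> is large when \<open>n\<close> is. If \<open>x\<close> is a
  nonnegative maximiser for \<open>G[W]\<close>, the Lagrange condition shows that removing \<open>v\<close> multiplies
  \<open>\<lambda>\<^sub>\<alpha>\<close> by at least \<open>(1 - 4t) / (1 - t)\<^bsup>\<tau>\<^esup>\<close> with \<open>t = x\<^sub>v\<^bsup>\<alpha>\<^esup>\<close>, so by the choice of \<open>W\<close> every
  \<open>t\<close> is at least \<open>(1 - \<delta>) / |W|\<close>. Thus \<open>x\<close> is nearly uniform, the Lagrange condition makes all
  degrees nearly \<open>|W|\<^sup>3 / 16\<close>, and degree stability makes \<open>G[W]\<close> colorable. For colorable graphs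
  \<open>\<lambda>\<^sub>\<alpha>\<close> is bounded by Maclaurin's inequality and the power mean inequality in each part, which
  gives \<open>\<lambda>\<^sub>\<alpha>(G[W]) \<le> \<lambda>\<^sub>\<alpha>(B\<^sub>4(|W|))\<close>. Since \<open>\<lambda>\<^sub>\<alpha>(B\<^sub>4(n)) n\<^sup>-\<^sup>s\<close> is strictly increasing, \<open>W\<close> is the
  whole vertex set; since \<open>x\<close> is positive, no edge between balanced parts is missing.
\<close>

section \<open>Nonnegative maximisers\<close>

text \<open>Expanding the k-th power of the sum gives one product per k-tuple from \<open>W\<close>.
  Listing each edge in one chosen order embeds \<open>E\<close> injectively into these tuples, and
  every remaining tuple has a product of at least l^k. Subtracting l^k throughout makes the bound
  sharp for nearly constant weights; l = 0 gives the plain bound on an edge sum.\<close>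

lemma sum_prod_subsets_diff_le:
  fixes x :: "'a \<Rightarrow> real"
  assumes fin: "finite W" and E: "\<And>e. e \<in> E \<Longrightarrow> e \<subseteq> W \<and> card e = k"
    and l: "0 \<le> l" and x: "\<And>w. w \<in> W \<Longrightarrow> l \<le> x w"
  shows "(\<Sum>e\<in>E. (\<Prod>w\<in>e. x w) - l ^ k) \<le> (\<Sum>w\<in>W. x w) ^ k - (real (card W) * l) ^ k"
proof -
  have "\<exists>g. g \<in> {..<k} \<rightarrow>\<^sub>E W \<and> bij_betw g {..<k} e" if e: "e \<in> E" for e
  proof -
    have "finite e" using E[OF e] fin finite_subset by blast
    then obtain g where g: "bij_betw g {..<k} e"
      using E[OF e] by (metis bij_betw_iff_card card_lessThan finite_lessThan)
    have "bij_betw (restrict g {..<k}) {..<k} e"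
      using g by (simp add: bij_betw_def inj_on_def)
    moreover have "restrict g {..<k} \<in> {..<k} \<rightarrow>\<^sub>E W"
      using g E[OF e] by (auto simp: bij_betw_def)
    ultimately show ?thesis by blast
  qed
  then obtain g where g: "\<And>e. e \<in> E \<Longrightarrow> g e \<in> {..<k} \<rightarrow>\<^sub>E W \<and> bij_betw (g e) {..<k} e"
    by metis
  have inj: "inj_on g E"
    by (intro inj_onI) (metis g bij_betw_imp_surj_on)
  have expand: "(\<Sum>w\<in>W. y w) ^ k = (\<Sum>h\<in>{..<k} \<rightarrow>\<^sub>E W. \<Prod>i<k. y (h i))" for y :: "'a \<Rightarrow> real"
    using prod_sum_PiE[of "{..<k}" "\<lambda>_. W" "\<lambda>_ w. y w"] fin by simp
  have "(\<Sum>e\<in>E. (\<Prod>w\<in>e. x w) - l ^ k) = (\<Sum>e\<in>E. (\<Prod>i<k. x (g e i)) - l ^ k)"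
  proof (intro sum.cong refl)
    fix e assume "e \<in> E"
    then have "bij_betw (g e) {..<k} e" using g by blast
    from prod.reindex_bij_betw[OF this, of x]
    show "(\<Prod>w\<in>e. x w) - l ^ k = (\<Prod>i<k. x (g e i)) - l ^ k" by simp
  qed
  also have "\<dots> = (\<Sum>h\<in>g ` E. (\<Prod>i<k. x (h i)) - l ^ k)"
    by (simp add: sum.reindex[OF inj])
  also have "\<dots> \<le> (\<Sum>h\<in>{..<k} \<rightarrow>\<^sub>E W. (\<Prod>i<k. x (h i)) - l ^ k)"
  proof (rule sum_mono2)
    show "finite ({..<k} \<rightarrow>\<^sub>E W)" using fin by (intro finite_PiE) auto
    show "g ` E \<subseteq> {..<k} \<rightarrow>\<^sub>E W" using g by auto
    fix h assume "h \<in> ({..<k} \<rightarrow>\<^sub>E W) - g ` E"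
    then have "(\<Prod>i<k. l) \<le> (\<Prod>i<k. x (h i))"
      by (intro prod_mono) (use l x in auto)
    then show "0 \<le> (\<Prod>i<k. x (h i)) - l ^ k" by simp
  qed
  also have "\<dots> = (\<Sum>w\<in>W. x w) ^ k - (real (card W) * l) ^ k"
    using expand[of x] expand[of "\<lambda>_. l"] by (simp add: sum_subtractf)
  finally show ?thesis .
qed

text \<open>Bernoulli's inequality for real exponents: a convex function lies above its tangent at
  1. The point 0 is treated apart because the tangent argument runs on the open half-line.\<close>

lemma powr_ge_tangent:
  fixes z :: real
  assumes "0 \<le> z" "1 \<le> \<alpha>"
  shows "1 + \<alpha> * (z - 1) \<le> z powr \<alpha>"
proof (cases "z = 0")
  case False
  then have z: "0 < z" using assms by simp
  have "((\<lambda>z. z powr \<alpha>) has_real_derivative \<alpha> * 1 powr (\<alpha> - 1)) (at 1 within {0<..})"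
    by (auto intro!: derivative_eq_intros)
  from convex_on_imp_above_tangent[OF _ _ _ _ this, of z] show ?thesis
    using z assms convex_on_subset[OF powr_convex[of \<alpha>]] 
    by (auto simp: algebra_simps interior_open)
qed (use assms in auto)

text \<open>The power mean inequality. After division by the mean \<open>M\<close> the tangent
  inequality is applied to every entry; the scaled entries average 1, so the linear terms
  cancel.\<close>

lemma sum_le_card_powr_mult_powr:
  fixes x :: "'a \<Rightarrow> real"
  assumes fin: "finite A" and x: "\<And>v. v \<in> A \<Longrightarrow> 0 \<le> x v" and \<alpha>: "1 \<le> \<alpha>"
  shows "(\<Sum>v\<in>A. x v) \<le> real (card A) powr (1 - 1 / \<alpha>) * (\<Sum>v\<in>A. x v powr \<alpha>) powr (1 / \<alpha>)"
proof (cases "(\<Sum>v\<in>A. x v) = 0")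
  case False
  define a where "a = real (card A)"
  define M where "M = (\<Sum>v\<in>A. x v) / a"
  have S: "0 < (\<Sum>v\<in>A. x v)" using False sum_nonneg[of A x] x by fastforce
  have a: "0 < a" using S fin by (auto simp: a_def card_gt_0_iff)
  have M: "0 < M" using S a by (simp add: M_def)
  have "(\<Sum>v\<in>A. x v / M) = a"
    using S a by (subst sum_divide_distrib[symmetric]) (simp add: M_def)
  then have "a = (\<Sum>v\<in>A. 1 + \<alpha> * (x v / M - 1))"
    by (simp add: sum.distrib sum_distrib_left[symmetric] sum_subtractf a_def)
  also have "\<dots> \<le> (\<Sum>v\<in>A. (x v / M) powr \<alpha>)"
    by (intro sum_mono powr_ge_tangent) (use x M \<alpha> in auto)
  also have "\<dots> = (\<Sum>v\<in>A. x v powr \<alpha>) / M powr \<alpha>"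
    using x M by (simp add: powr_divide sum_divide_distrib)
  finally have "a * M powr \<alpha> \<le> (\<Sum>v\<in>A. x v powr \<alpha>)"
    using M by (simp add: field_simps)
  then have "(a * M powr \<alpha>) powr (1 / \<alpha>) \<le> (\<Sum>v\<in>A. x v powr \<alpha>) powr (1 / \<alpha>)"
    by (intro powr_mono2) (use \<alpha> a in auto)
  then have "a powr (1 / \<alpha>) * M \<le> (\<Sum>v\<in>A. x v powr \<alpha>) powr (1 / \<alpha>)"
    using a M \<alpha> by (simp add: powr_mult powr_powr)
  then have "a powr (1 - 1 / \<alpha>) * (a powr (1 / \<alpha>) * M)
      \<le> a powr (1 - 1 / \<alpha>) * (\<Sum>v\<in>A. x v powr \<alpha>) powr (1 / \<alpha>)"
    by (intro mult_left_mono) auto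
  moreover have "a powr (1 - 1 / \<alpha>) * (a powr (1 / \<alpha>) * M) = (\<Sum>v\<in>A. x v)"
    using a by (simp add: mult.assoc[symmetric] powr_add[symmetric] M_def)
  ultimately show ?thesis by (simp add: a_def)
qed auto

section \<open>Homogeneity and the Lagrange condition\<close>

lemma kgraph_finite_edges:
  assumes "kgraph k H"
  shows "finite (edges H)"
proof (rule finite_subset)
  show "edges H \<subseteq> Pow (verts H)" "finite (Pow (verts H))"
    using assms by (auto simp: kgraph_def)
qed

lemma lagr_le_lambda_spec:
  assumes "kgraph k H" "verts H \<noteq> {}" "\<alpha> > 0" "(\<Sum>v\<in>verts H. \<bar>y v\<bar> powr \<alpha>) = 1"
  shows "lagr k H y \<le> lambda_spec k \<alpha> H"
  using lambda_spec_attained[OF assms(1-3)] assms(4) by metis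

lemma lagr_scale:
  assumes "kgraph k H"
  shows "lagr k H (\<lambda>v. c * y v) = c ^ k * lagr k H y"
proof -
  have "(\<Prod>v\<in>e. c * y v) = c ^ k * (\<Prod>v\<in>e. y v)" if "e \<in> edges H" for e
    using assms that by (auto simp: kgraph_def prod.distrib)
  then show ?thesis by (simp add: lagr_def sum_distrib_left mult_ac)
qed

text \<open>The extremal bound for vectors of any norm: \<open>lagr\<close> has degree k in y and
  the power sum \<open>N\<close> has degree \<alpha>, hence the exponent k/\<alpha>. If
  \<open>N\<close> vanishes, k > 0 puts a zero factor into every edge product.\<close>

lemma lagr_le_lambda_spec_mult:
  assumes H: "kgraph k H" and ne: "verts H \<noteq> {}" and \<alpha>: "\<alpha> > 0" and k: "k > 0"
  shows "lagr k H y \<le> lambda_spec k \<alpha> H * (\<Sum>v\<in>verts H. \<bar>y v\<bar> powr \<alpha>) powr (real k / \<alpha>)"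
proof -
  define N where "N = (\<Sum>v\<in>verts H. \<bar>y v\<bar> powr \<alpha>)"
  have fin: "finite (verts H)" using H by (simp add: kgraph_def)
  have N0: "0 \<le> N" by (simp add: N_def sum_nonneg)
  show ?thesis
  proof (cases "N = 0")
    case True
    then have y: "\<And>v. v \<in> verts H \<Longrightarrow> y v = 0"
      using fin by (auto simp: N_def sum_nonneg_eq_0_iff)
    have "(\<Prod>v\<in>e. y v) = 0" if e: "e \<in> edges H" for e
    proof -
      have "e \<noteq> {}" "finite e" "e \<subseteq> verts H"
        using H e k fin by (auto simp: kgraph_def intro: finite_subset)
      then show ?thesis using y by (auto intro!: prod_zero)
    qed
    then show ?thesis using True by (simp add: lagr_def N_def)
  next
    case False
    then have N: "0 < N" using N0 by simp
    define c where "c = N powr (- 1 / \<alpha>)"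
    have c: "0 < c" using N by (simp add: c_def)
    have "(\<Sum>v\<in>verts H. \<bar>c * y v\<bar> powr \<alpha>) = c powr \<alpha> * N"
      using c by (simp add: abs_mult powr_mult N_def sum_distrib_left)
    also have "c powr \<alpha> = N powr - 1"
      unfolding c_def powr_powr using \<alpha> by simp
    also have "N powr - 1 * N = 1" using N by (simp add: powr_minus)
    finally have "lagr k H (\<lambda>v. c * y v) \<le> lambda_spec k \<alpha> H"
      by (rule lagr_le_lambda_spec[OF H ne \<alpha>])
    then have "c ^ k * lagr k H y \<le> lambda_spec k \<alpha> H" by (simp add: lagr_scale[OF H])
    moreover have "c ^ k = N powr (- (real k / \<alpha>))"
      using N c by (simp add: c_def powr_powr flip: powr_realpow)
    ultimately show ?thesis
      using N by (simp add: powr_minus field_simps N_def)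
  qed
qed

lemma lambda_spec_attained_nonneg:
  assumes H: "kgraph k H" and ne: "verts H \<noteq> {}" and \<alpha>: "\<alpha> > 0"
  obtains x where "\<And>v. 0 \<le> x v" "(\<Sum>v\<in>verts H. x v powr \<alpha>) = 1" "lagr k H x = lambda_spec k \<alpha> H"
proof -
  obtain x where x: "(\<Sum>v\<in>verts H. \<bar>x v\<bar> powr \<alpha>) = 1" "lagr k H x = lambda_spec k \<alpha> H"
    using lambda_spec_attained[OF assms] by blast
  have "lagr k H x \<le> lagr k H (\<lambda>v. \<bar>x v\<bar>)"
    unfolding lagr_def by (intro mult_left_mono sum_mono) (simp_all flip: abs_prod)
  moreover have "lagr k H (\<lambda>v. \<bar>x v\<bar>) \<le> lambda_spec k \<alpha> H"
    by (rule lagr_le_lambda_spec[OF assms]) (use x in simp)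
  ultimately show ?thesis using x that[of "\<lambda>v. \<bar>x v\<bar>"] by simp
qed

text \<open>The partial derivative of \<open>lagr k H\<close> with respect to \<open>x v\<close>.\<close>

definition link_sum :: "nat \<Rightarrow> 'a hypergraph \<Rightarrow> ('a \<Rightarrow> real) \<Rightarrow> 'a \<Rightarrow> real" where
  "link_sum k H x v = fact k * (\<Sum>e\<in>{e \<in> edges H. v \<in> e}. \<Prod>w\<in>e - {v}. x w)"

text \<open>Edges are sets, so \<open>x v\<close> enters each edge product at most to the first
  power, and \<open>lagr\<close> is affine in every single coordinate.\<close>

lemma lagr_fun_upd:
  assumes H: "kgraph k H"
  shows "lagr k H (x(v := t)) = lagr k H x + (t - x v) * link_sum k H x v"
proof -
  have fe: "finite (edges H)" by (rule kgraph_finite_edges[OF H])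
  have p: "(\<Prod>w\<in>e. (x(v := t)) w) = (\<Prod>w\<in>e. x w) + (if v \<in> e then (t - x v) * (\<Prod>w\<in>e - {v}. x w) else 0)"
    if "e \<in> edges H" for e
  proof -
    have fin: "finite e" using H that by (auto simp: kgraph_def intro: finite_subset)
    show ?thesis
    proof (cases "v \<in> e")
      case True
      have "(\<Prod>w\<in>e - {v}. (x(v := t)) w) = (\<Prod>w\<in>e - {v}. x w)" by (intro prod.cong) auto
      then show ?thesis using True fin
        by (simp add: prod.remove[of e v] algebra_simps)
    qed (auto intro!: prod.cong)
  qed
  have "(\<Sum>e\<in>edges H. \<Prod>w\<in>e. (x(v := t)) w)
      = (\<Sum>e\<in>edges H. \<Prod>w\<in>e. x w) + (t - x v) * (\<Sum>e\<in>{e \<in> edges H. v \<in> e}. \<Prod>w\<in>e - {v}. x w)"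
    using fe by (simp add: p sum.distrib sum.inter_filter sum_distrib_left del: fun_upd_apply)
      (auto intro!: sum.cong)
  then show ?thesis by (simp only: lagr_def link_sum_def distrib_left mult.left_commute)
qed

text \<open>A Lagrange multiplier rule without constrained optimisation: the homogeneous bound holds
  for every positive value of coordinate v and is tight at the maximiser, so its slack has a local
  minimum there.\<close>

lemma link_sum_eq_at_maximizer:
  assumes H: "kgraph k H" and ne: "verts H \<noteq> {}" and \<alpha>: "\<alpha> > 0" and k: "k > 0"
    and x: "\<And>v. 0 \<le> x v" "(\<Sum>v\<in>verts H. x v powr \<alpha>) = 1" "lagr k H x = lambda_spec k \<alpha> H"
    and v: "v \<in> verts H" "0 < x v"
  shows "link_sum k H x v = real k * lambda_spec k \<alpha> H * x v powr (\<alpha> - 1)"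
proof -
  define lam where "lam = lambda_spec k \<alpha> H"
  define D where "D = link_sum k H x v"
  \<comment> \<open>The slack of the homogeneous bound at \<open>x(v := t)\<close>, whose power sum
    is 1 - (x v)^\<alpha> + t^\<alpha> and whose \<open>lagr\<close> is affine in t with slope
    \<open>D\<close>.\<close>
  define \<phi> where "\<phi> t = lam * (1 - x v powr \<alpha> + t powr \<alpha>) powr (real k / \<alpha>) - (lam + (t - x v) * D)" for t
  have fin: "finite (verts H)" using H by (simp add: kgraph_def)
  have "0 \<le> \<phi> t" if t: "0 < t" for t
  proof -
    have "(\<Sum>w\<in>verts H. \<bar>(x(v := t)) w\<bar> powr \<alpha>) = t powr \<alpha> + (\<Sum>w\<in>verts H - {v}. x w powr \<alpha>)"
      using fin v t x(1) by (auto simp: sum.remove[of _ v] intro!: sum.cong)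
    also have "\<dots> = 1 - x v powr \<alpha> + t powr \<alpha>"
      using x(2) fin v by (simp add: sum.remove[of _ v])
    finally show ?thesis
      using lagr_le_lambda_spec_mult[OF H ne \<alpha> k, of "x(v := t)"] 
      by (simp add: lagr_fun_upd[OF H] x(3) \<phi>_def lam_def D_def)
  qed
  moreover have "\<phi> (x v) = 0" by (simp add: \<phi>_def)
  ultimately have "\<forall>t. \<bar>x v - t\<bar> < x v \<longrightarrow> \<phi> (x v) \<le> \<phi> t" by auto
  moreover have "(\<phi> has_real_derivative real k * lam * x v powr (\<alpha> - 1) - D) (at (x v))"
    unfolding \<phi>_def by (auto intro!: derivative_eq_intros) (use v \<alpha> in \<open>auto simp: powr_diff\<close>)
  ultimately have "real k * lam * x v powr (\<alpha> - 1) - D = 0"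
    using DERIV_local_min v by blast
  then show ?thesis by (simp add: D_def lam_def)
qed

section \<open>Induced subgraphs and isomorphisms\<close>

lemma kgraph_finite_edge:
  assumes "kgraph k H" "e \<in> edges H"
  shows "finite e"
  using assms finite_subset[of e "verts H"] by (simp add: kgraph_def)

definition induced :: "'a hypergraph \<Rightarrow> 'a set \<Rightarrow> 'a hypergraph" where
  "induced G W = (W, {e \<in> edges G. e \<subseteq> W})"

lemma verts_induced [simp]: "verts (induced G W) = W"
  and edges_induced [simp]: "edges (induced G W) = {e \<in> edges G. e \<subseteq> W}"
  by (simp_all add: induced_def)

lemma kgraph_induced:
  assumes "kgraph k G" "W \<subseteq> verts G"
  shows "kgraph k (induced G W)"
  using assms by (auto simp: kgraph_def intro: finite_subset)

lemma free_of_induced: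
  assumes "free_of \<F> G" "W \<subseteq> verts G"
  shows "free_of \<F> (induced G W)"
  unfolding free_of_def
proof
  fix F assume "F \<in> \<F>"
  then have "\<not> contains G F" using assms by (simp add: free_of_def)
  moreover have "contains G F" if c: "contains (induced G W) F"
  proof -
    obtain f where "inj_on f (verts F)" "f ` verts F \<subseteq> W" "\<forall>e\<in>edges F. f ` e \<in> edges G"
      using c by (auto simp: contains_def)
    then show ?thesis using assms(2) unfolding contains_def by blast
  qed
  ultimately show "\<not> contains (induced G W) F" by blast
qed

lemma induced_induced: "U \<subseteq> W \<Longrightarrow> induced (induced G W) U = induced G U"
  by (auto simp: induced_def)

lemma induced_verts: "kgraph k G \<Longrightarrow> induced G (verts G) = G"
  by (cases G) (auto simp: induced_def kgraph_def)

text \<open>Setting coordinate v to 0 lowers \<open>lagr\<close> by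
  \<open>x v * link_sum k H x v\<close>, which the Lagrange condition evaluates. The rest of the
  vector lives on the smaller graph with power sum 1 - (x v)^\<alpha>, where the homogeneous bound
  applies.\<close>

lemma lambda_spec_delete_vertex:
  assumes H: "kgraph k H" and \<alpha>: "\<alpha> > 0" and k: "k > 0"
    and x: "\<And>v. 0 \<le> x v" "(\<Sum>v\<in>verts H. x v powr \<alpha>) = 1" "lagr k H x = lambda_spec k \<alpha> H"
    and v: "v \<in> verts H" and ne: "verts H - {v} \<noteq> {}"
  shows "lambda_spec k \<alpha> H * (1 - real k * x v powr \<alpha>)
    \<le> lambda_spec k \<alpha> (induced H (verts H - {v})) * (1 - x v powr \<alpha>) powr (real k / \<alpha>)"
proof -
  let ?H' = "induced H (verts H - {v})"
  have fin: "finite (verts H)" using H by (simp add: kgraph_def)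
  have vne: "verts H \<noteq> {}" using v by blast
  have link: "x v * link_sum k H x v = lambda_spec k \<alpha> H * (real k * x v powr \<alpha>)"
  \<comment> \<open>The Lagrange condition needs positive weight; at weight 0 both sides
    vanish.\<close>
  proof (cases "x v = 0")
    case False
    then have xv: "0 < x v" using x(1)[of v] by simp
    have "x v * x v powr (\<alpha> - 1) = x v powr \<alpha>"
      using xv powr_add[of "x v" 1 "\<alpha> - 1"] by simp
    then show ?thesis
      using link_sum_eq_at_maximizer[OF H vne \<alpha> k x v xv] by (simp add: mult_ac)
  qed (use \<alpha> in auto)
  have "lambda_spec k \<alpha> H * (1 - real k * x v powr \<alpha>) = lagr k H x - x v * link_sum k H x v"
    unfolding link x(3) by (simp add: algebra_simps)
  also have "\<dots> = lagr k H (x(v := 0))"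
    by (simp add: lagr_fun_upd[OF H])
  also have "\<dots> = lagr k ?H' x"
  proof -
    have "(\<Sum>e\<in>edges H. \<Prod>w\<in>e. (x(v := 0)) w) = (\<Sum>e\<in>edges ?H'. \<Prod>w\<in>e. x w)"
    proof (rule sum.mono_neutral_cong_right)
      show "finite (edges H)" by (rule kgraph_finite_edges[OF H])
      show "edges ?H' \<subseteq> edges H" by auto
      show "\<forall>e\<in>edges H - edges ?H'. (\<Prod>w\<in>e. (x(v := 0)) w) = 0"
      proof
        fix e assume e: "e \<in> edges H - edges ?H'"
        then have "v \<in> e" "finite e" using H kgraph_finite_edge[OF H] by (auto simp: kgraph_def)
        then show "(\<Prod>w\<in>e. (x(v := 0)) w) = 0" by (intro prod_zero) auto
      qed
      show "(\<Prod>w\<in>e. (x(v := 0)) w) = (\<Prod>w\<in>e. x w)" if "e \<in> edges ?H'" for e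
        using that by (intro prod.cong) auto
    qed
    then show ?thesis by (simp only: lagr_def)
  qed
  also have "\<dots> \<le> lambda_spec k \<alpha> ?H' * (\<Sum>w\<in>verts ?H'. \<bar>x w\<bar> powr \<alpha>) powr (real k / \<alpha>)"
    by (rule lagr_le_lambda_spec_mult[OF kgraph_induced[OF H] _ \<alpha> k]) (use ne in auto)
  also have "(\<Sum>w\<in>verts ?H'. \<bar>x w\<bar> powr \<alpha>) = 1 - x v powr \<alpha>"
    using x(1,2) fin v by (simp add: sum.remove[of _ v])
  finally show ?thesis .
qed

text \<open>A crude bound with the right growth exponent, from the plain edge-sum bound and the
  power mean inequality. It later excludes small optimal sets \<open>W\<close>.\<close>

lemma lambda_spec_le_powr:
  assumes H: "kgraph k H" and ne: "verts H \<noteq> {}" and \<alpha>: "\<alpha> \<ge> 1" and k: "k > 0"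
  shows "lambda_spec k \<alpha> H \<le> fact k * real (card (verts H)) powr (real k - real k / \<alpha>)"
proof -
  have fin: "finite (verts H)" using H by (simp add: kgraph_def)
  obtain x where x: "\<And>v. 0 \<le> x v" "(\<Sum>v\<in>verts H. x v powr \<alpha>) = 1" "lagr k H x = lambda_spec k \<alpha> H"
    using lambda_spec_attained_nonneg[OF H ne, of \<alpha>] \<alpha> by auto
  have "(\<Sum>e\<in>edges H. \<Prod>w\<in>e. x w) \<le> (\<Sum>v\<in>verts H. x v) ^ k"
    using sum_prod_subsets_diff_le[OF fin, of "edges H" k 0 x] H k x(1)
    by (simp add: kgraph_def power_0_left)
  also have "\<dots> \<le> (real (card (verts H)) powr (1 - 1 / \<alpha>)) ^ k"
    using sum_le_card_powr_mult_powr[OF fin _ \<alpha>, of x] x(1,2)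
    by (intro power_mono) (auto intro: sum_nonneg)
  also have "\<dots> = real (card (verts H)) powr (real k - real k / \<alpha>)"
    using fin ne k by (simp add: card_gt_0_iff powr_powr algebra_simps flip: powr_realpow)
  finally show ?thesis unfolding x(3)[symmetric] lagr_def by (intro mult_left_mono) auto
qed

lemma lambda_spec_hiso:
  assumes H: "kgraph k H" and iso: "hiso G H" and G: "kgraph k G"
  shows "lambda_spec k \<alpha> G = lambda_spec k \<alpha> H"
proof -
  obtain f where f: "bij_betw f (verts G) (verts H)" and fE: "(\<lambda>e. f ` e) ` edges G = edges H"
    using iso by (auto simp: hiso_def)
  have injE: "inj_on (\<lambda>e. f ` e) (edges G)"
    using G f by (intro inj_onI) (metis bij_betw_def inj_on_image_eq_iff kgraph_def)
  have lag: "lagr k H y = lagr k G (y \<circ> f)" for y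
  proof -
    have "(\<Sum>e\<in>edges H. \<Prod>v\<in>e. y v) = (\<Sum>e\<in>edges G. \<Prod>v\<in>f ` e. y v)"
      unfolding fE[symmetric] by (simp add: sum.reindex[OF injE])
    also have "\<dots> = (\<Sum>e\<in>edges G. \<Prod>v\<in>e. (y \<circ> f) v)"
    proof (intro sum.cong refl)
      fix e assume "e \<in> edges G"
      then have "inj_on f e" using G f by (auto simp: kgraph_def bij_betw_def intro: inj_on_subset)
      then show "(\<Prod>v\<in>f ` e. y v) = (\<Prod>v\<in>e. (y \<circ> f) v)" by (simp add: prod.reindex)
    qed
    finally show ?thesis by (simp add: lagr_def)
  qed
  have nrm: "(\<Sum>v\<in>verts H. \<bar>y v\<bar> powr \<alpha>) = (\<Sum>v\<in>verts G. \<bar>(y \<circ> f) v\<bar> powr \<alpha>)" for y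
    using sum.reindex_bij_betw[OF f, of "\<lambda>v. \<bar>y v\<bar> powr \<alpha>"] by simp
  have "{lagr k G x | x. (\<Sum>v\<in>verts G. \<bar>x v\<bar> powr \<alpha>) = 1}
      = {lagr k H y | y. (\<Sum>v\<in>verts H. \<bar>y v\<bar> powr \<alpha>) = 1}" (is "?L = ?R")
  proof
    show "?R \<subseteq> ?L" using lag nrm by fastforce
    show "?L \<subseteq> ?R"
    proof
      fix z assume "z \<in> ?L"
      then obtain x where x: "z = lagr k G x" "(\<Sum>v\<in>verts G. \<bar>x v\<bar> powr \<alpha>) = 1" by blast
      \<comment> \<open>\<open>y \<circ> f\<close> agrees with \<open>x\<close> on
        \<open>verts G\<close>, which is all that \<open>lagr\<close> and the norm see.\<close>
      define y where "y = x \<circ> inv_into (verts G) f"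
      have yf: "(y \<circ> f) v = x v" if "v \<in> verts G" for v
        using that f by (simp add: y_def bij_betw_def)
      have "lagr k G (y \<circ> f) = lagr k G x"
      proof -
        have "(\<Prod>v\<in>e. (y \<circ> f) v) = (\<Prod>v\<in>e. x v)" if "e \<in> edges G" for e
          using that G yf by (intro prod.cong) (auto simp: kgraph_def)
        then show ?thesis by (simp only: lagr_def cong: sum.cong)
      qed
      moreover have "(\<Sum>v\<in>verts G. \<bar>(y \<circ> f) v\<bar> powr \<alpha>) = 1"
        using x(2) yf by (simp only: cong: sum.cong)
      ultimately show "z \<in> ?R"
        using x(1) lag[of y] nrm[of y] by (intro CollectI exI[of _ y]) simp
    qed
  qed
  then show ?thesis by (simp add: lambda_spec_def)
qed

section \<open>Colorable 4-graphs\<close>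

definition two_subsets :: "'a set \<Rightarrow> 'a set set" where
  "two_subsets A = {T. T \<subseteq> A \<and> card T = 2}"

definition complete22 :: "'a set \<Rightarrow> 'a set \<Rightarrow> 'a set set" where
  "complete22 A B = {e. e \<subseteq> A \<union> B \<and> card (e \<inter> A) = 2 \<and> card (e \<inter> B) = 2}"

text \<open>Newton's identity for the second elementary symmetric polynomial. In the induction the
  pairs through the new element \<open>a\<close> contribute \<open>x a\<close> times the sum over
  \<open>A\<close>.\<close>

lemma sum_prod_two_subsets:
  fixes x :: "'a \<Rightarrow> real"
  assumes "finite A"
  shows "2 * (\<Sum>T\<in>two_subsets A. \<Prod>v\<in>T. x v) = (\<Sum>v\<in>A. x v)\<^sup>2 - (\<Sum>v\<in>A. (x v)\<^sup>2)"
  using assms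
proof (induction A)
  case empty
  have "two_subsets {} = ({} :: 'a set set)" by (auto simp: two_subsets_def)
  then show ?case by simp
next
  case (insert a A)
  have eq: "two_subsets (insert a A) = two_subsets A \<union> (\<lambda>b. {a, b}) ` A" (is "?L = ?R")
  proof (intro equalityI subsetI)
    fix T assume T: "T \<in> ?L"
    show "T \<in> ?R"
    proof (cases "a \<in> T")
      case True
      then obtain b where "T = {a, b}" "a \<noteq> b"
        using T by (auto simp: two_subsets_def card_2_iff)
      then show ?thesis using T by (auto simp: two_subsets_def)
    qed (use T in \<open>auto simp: two_subsets_def\<close>)
  next
    fix T assume "T \<in> ?R"
    then show "T \<in> ?L"
      using insert.hyps by (auto simp: two_subsets_def card_2_iff)
  qed
  have "finite (two_subsets A)" using insert.hyps by (simp add: two_subsets_def)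
  moreover have "two_subsets A \<inter> (\<lambda>b. {a, b}) ` A = {}"
    using insert.hyps by (auto simp: two_subsets_def)
  ultimately have "(\<Sum>T\<in>two_subsets (insert a A). \<Prod>v\<in>T. x v)
      = (\<Sum>T\<in>two_subsets A. \<Prod>v\<in>T. x v) + (\<Sum>T\<in>(\<lambda>b. {a, b}) ` A. \<Prod>v\<in>T. x v)"
    unfolding eq using insert.hyps by (intro sum.union_disjoint) auto
  also have "(\<Sum>T\<in>(\<lambda>b. {a, b}) ` A. \<Prod>v\<in>T. x v) = (\<Sum>b\<in>A. \<Prod>v\<in>{a, b}. x v)"
    by (subst sum.reindex) (auto simp: inj_on_def doubleton_eq_iff)
  also have "\<dots> = x a * (\<Sum>b\<in>A. x b)"
    unfolding sum_distrib_left
  proof (intro sum.cong refl)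
    fix b assume "b \<in> A"
    then have "a \<noteq> b" using insert.hyps by blast
    then show "(\<Prod>v\<in>{a, b}. x v) = x a * x b" by simp
  qed
  finally show ?case using insert.IH insert.hyps by (simp add: power2_eq_square algebra_simps)
qed

text \<open>An edge splits uniquely into its traces on \<open>A\<close> and \<open>B\<close>, so the
  sum factors.\<close>

lemma sum_prod_complete22:
  fixes x :: "'a \<Rightarrow> real"
  assumes fin: "finite A" "finite B" and dj: "A \<inter> B = {}"
  shows "(\<Sum>e\<in>complete22 A B. \<Prod>v\<in>e. x v)
    = (\<Sum>T\<in>two_subsets A. \<Prod>v\<in>T. x v) * (\<Sum>T\<in>two_subsets B. \<Prod>v\<in>T. x v)"
proof -
  have "(\<Sum>T\<in>two_subsets A. \<Prod>v\<in>T. x v) * (\<Sum>T\<in>two_subsets B. \<Prod>v\<in>T. x v)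
      = (\<Sum>(S, T)\<in>two_subsets A \<times> two_subsets B. (\<Prod>v\<in>S. x v) * (\<Prod>v\<in>T. x v))"
    by (simp add: sum_product sum.cartesian_product)
  also have "\<dots> = (\<Sum>e\<in>complete22 A B. \<Prod>v\<in>e. x v)"
  proof (rule sum.reindex_bij_witness[of _ "\<lambda>e. (e \<inter> A, e \<inter> B)" "\<lambda>(S, T). S \<union> T"])
    fix p assume p: "p \<in> two_subsets A \<times> two_subsets B"
    then obtain S T where ST: "p = (S, T)" "S \<subseteq> A" "T \<subseteq> B" "card S = 2" "card T = 2"
      by (auto simp: two_subsets_def)
    have i: "(S \<union> T) \<inter> A = S" "(S \<union> T) \<inter> B = T" using ST dj by auto
    show "((case p of (S, T) \<Rightarrow> S \<union> T) \<inter> A, (case p of (S, T) \<Rightarrow> S \<union> T) \<inter> B) = p"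
      using i ST by simp
    show "(case p of (S, T) \<Rightarrow> S \<union> T) \<in> complete22 A B"
      using i ST by (auto simp: complete22_def)
    have "finite S" "finite T" "S \<inter> T = {}" using ST fin dj by (auto intro: finite_subset)
    then show "(\<Prod>v\<in>(case p of (S, T) \<Rightarrow> S \<union> T). x v) = (case p of (S, T) \<Rightarrow> (\<Prod>v\<in>S. x v) * (\<Prod>v\<in>T. x v))"
      using ST by (simp add: prod.union_disjoint)
  qed (auto simp: complete22_def two_subsets_def)
  finally show ?thesis by simp
qed

lemma colorable_pattern22_iff:
  assumes H: "kgraph 4 H"
  shows "colorable pattern22 H \<longleftrightarrow>
    (\<exists>A B. A \<inter> B = {} \<and> A \<union> B = verts H \<and> edges H \<subseteq> complete22 A B)"
proof
  assume "colorable pattern22 H"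
  then obtain \<phi> where \<phi>: "\<phi> ` verts H \<subseteq> {1..2 :: nat}"
    and E: "\<And>e. e \<in> edges H \<Longrightarrow> image_mset \<phi> (mset_set e) = {#1, 1, 2, 2#}"
    by (auto simp: colorable_def pattern22_def)
  define A where "A = {v \<in> verts H. \<phi> v = 1}"
  define B where "B = {v \<in> verts H. \<phi> v = 2}"
  have "e \<in> complete22 A B" if e: "e \<in> edges H" for e
  proof -
    have sub: "e \<subseteq> verts H" and fin: "finite e"
      using H e kgraph_finite_edge[OF H] by (auto simp: kgraph_def)
    \<comment> \<open>The multiplicity of a colour in the image multiset is the number of vertices
      of \<open>e\<close> with that colour.\<close>
    have cnt: "card {v \<in> e. \<phi> v = c} = count {#1, 1, 2, 2#} c" for c
      unfolding E[OF e, symmetric] using fin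
      by (simp add: count_image_mset' sum.If_cases Int_def conj_commute eq_commute)
    have "e \<inter> A = {v \<in> e. \<phi> v = 1}" "e \<inter> B = {v \<in> e. \<phi> v = 2}"
      using sub by (auto simp: A_def B_def)
    then have "card (e \<inter> A) = 2" "card (e \<inter> B) = 2" using cnt[of 1] cnt[of 2] by simp_all
    moreover have "verts H = A \<union> B" using \<phi> by (force simp: A_def B_def)
    ultimately show ?thesis using sub by (auto simp: complete22_def)
  qed
  moreover have "A \<inter> B = {}" "A \<union> B = verts H" using \<phi> by (force simp: A_def B_def)+
  ultimately show "\<exists>A B. A \<inter> B = {} \<and> A \<union> B = verts H \<and> edges H \<subseteq> complete22 A B" by blast
next
  assume "\<exists>A B. A \<inter> B = {} \<and> A \<union> B = verts H \<and> edges H \<subseteq> complete22 A B"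
  then obtain A B where AB: "A \<inter> B = {}" "A \<union> B = verts H" "edges H \<subseteq> complete22 A B" by blast
  define \<phi> where "\<phi> v = (if v \<in> A then 1 else 2 :: nat)" for v
  have "image_mset \<phi> (mset_set e) = {#1, 1, 2, 2#}" if e: "e \<in> edges H" for e
  proof -
    have fin: "finite e" using H e kgraph_finite_edge[OF H] by (auto simp: kgraph_def)
    have e': "e \<subseteq> A \<union> B" "card (e \<inter> A) = 2" "card (e \<inter> B) = 2"
      using AB e by (auto simp: complete22_def)
    have "e = (e \<inter> A) \<union> (e \<inter> B)" using e' by auto
    then have "mset_set e = mset_set (e \<inter> A) + mset_set (e \<inter> B)"
      using mset_set_Union[of "e \<inter> A" "e \<inter> B"] fin AB by auto
    moreover have "image_mset \<phi> (mset_set (e \<inter> A)) = image_mset (\<lambda>_. 1) (mset_set (e \<inter> A))"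
      by (intro image_mset_cong) (use fin in \<open>auto simp: \<phi>_def\<close>)
    moreover have "image_mset \<phi> (mset_set (e \<inter> B)) = image_mset (\<lambda>_. 2) (mset_set (e \<inter> B))"
      by (intro image_mset_cong) (use fin AB in \<open>auto simp: \<phi>_def\<close>)
    ultimately show ?thesis using e' by (simp add: image_mset_const_eq numeral_2_eq_2)
  qed
  then show "colorable pattern22 H"
    by (auto simp: colorable_def pattern22_def \<phi>_def intro!: exI[of _ \<phi>])
qed

section \<open>The graph \<open>B4 n\<close>\<close>

lemma edges_B4: "edges (B4 n) = complete22 {..<n div 2} {n div 2..<n}"
  and verts_B4: "verts (B4 n) = {..<n}"
proof -
  have "{..<n} = {..<n div 2} \<union> {n div 2..<n}" by auto
  then show "edges (B4 n) = complete22 {..<n div 2} {n div 2..<n}"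
    by (simp add: B4_def complete22_def)
qed (simp add: B4_def)

lemma card_complete22_member:
  assumes "finite A" "finite B" "A \<inter> B = {}" "e \<in> complete22 A B"
  shows "card e = 4"
proof -
  have "e = (e \<inter> A) \<union> (e \<inter> B)" using assms by (auto simp: complete22_def)
  then have "card e = card (e \<inter> A) + card (e \<inter> B)"
    using assms card_Un_disjoint[of "e \<inter> A" "e \<inter> B"] by auto
  then show ?thesis using assms by (simp add: complete22_def)
qed

lemma kgraph_B4: "kgraph 4 (B4 n)"
proof -
  have "card e = 4" if "e \<in> edges (B4 n)" for e
    using that unfolding edges_B4 by (rule card_complete22_member[rotated 3]) auto
  moreover have "e \<subseteq> verts (B4 n)" if "e \<in> edges (B4 n)" for e
    using that by (simp add: B4_def)
  ultimately show ?thesis by (simp add: kgraph_def verts_B4)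
qed

lemma colorable_B4: "colorable pattern22 (B4 n)"
proof -
  have "{..<n div 2} \<inter> {n div 2..<n} = {}" "{..<n div 2} \<union> {n div 2..<n} = verts (B4 n)"
    by (auto simp: verts_B4)
  then show ?thesis
    unfolding colorable_pattern22_iff[OF kgraph_B4] using edges_B4[of n] by blast
qed

text \<open>Bijections between the parts glue to one between the vertex sets. It preserves
  intersection sizes, and \<open>complete22\<close> is defined by these alone, so edges correspond
  in both directions.\<close>

lemma hiso_B4I:
  assumes fin: "finite A" "finite B" and dj: "A \<inter> B = {}"
    and V: "verts G = A \<union> B" and E: "edges G = complete22 A B"
    and cA: "card A = n div 2" and cB: "card B = n - n div 2"
  shows "hiso G (B4 n)"
proof -
  obtain f where f: "bij_betw f A {..<n div 2}"
    using fin cA by (metis bij_betw_iff_card card_lessThan finite_lessThan)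
  obtain g where g: "bij_betw g B {n div 2..<n}"
    using fin cB by (metis bij_betw_iff_card card_atLeastLessThan finite_atLeastLessThan)
  define h where "h v = (if v \<in> A then f v else g v)" for v
  have hA: "bij_betw h A {..<n div 2}" using f by (subst bij_betw_cong[of _ _ f]) (auto simp: h_def)
  have hB: "bij_betw h B {n div 2..<n}" using g dj by (subst bij_betw_cong[of _ _ g]) (auto simp: h_def)
  have h: "bij_betw h (A \<union> B) {..<n}"
  proof -
    have "{..<n} = {..<n div 2} \<union> {n div 2..<n}" by auto
    moreover have "{..<n div 2} \<inter> {n div 2..<n} = {}" by auto
    ultimately show ?thesis using bij_betw_combine[OF hA hB] by simp
  qed
  have card_h: "card (h ` e \<inter> h ` X) = card (e \<inter> X)" if "e \<subseteq> A \<union> B" "X \<subseteq> A \<union> B" for e X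
  proof -
    have "h ` e \<inter> h ` X = h ` (e \<inter> X)"
      using h that by (metis bij_betw_def inj_on_image_Int)
    moreover have "inj_on h (e \<inter> X)" using h that by (auto simp: bij_betw_def intro: inj_on_subset)
    ultimately show ?thesis by (simp add: card_image)
  qed
  have imA: "h ` A = {..<n div 2}" and imB: "h ` B = {n div 2..<n}"
    using hA hB by (auto simp: bij_betw_def)
  have "(\<lambda>e. h ` e) ` complete22 A B = complete22 (h ` A) (h ` B)"
  proof (intro equalityI subsetI)
    fix e' assume "e' \<in> (\<lambda>e. h ` e) ` complete22 A B"
    then show "e' \<in> complete22 (h ` A) (h ` B)"
      using card_h by (auto simp: complete22_def)
  next
    fix e' assume e': "e' \<in> complete22 (h ` A) (h ` B)"
    then have "e' \<subseteq> h ` (A \<union> B)" by (auto simp: complete22_def image_Un)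
    then obtain e where "e \<subseteq> A \<union> B" "e' = h ` e" by (auto simp: subset_image_iff)
    then show "e' \<in> (\<lambda>e. h ` e) ` complete22 A B"
      using e' card_h[of e A] card_h[of e B] by (auto simp: complete22_def)
  qed
  then show ?thesis
    unfolding hiso_def using h by (auto simp: V E edges_B4 verts_B4 imA imB)
qed

text \<open>
  With \<open>p = |A| |B|\<close> and \<open>m = |A| + |B|\<close> this is \<open>\<lambda>\<^sub>\<alpha>\<close> of the 4-graph with edge set
  \<open>complete22 A B\<close>; the factor \<open>1 - (m - 1) / p\<close> is \<open>(1 - 1 / |A|) (1 - 1 / |B|)\<close>.
\<close>

definition bip_value :: "real \<Rightarrow> real \<Rightarrow> real \<Rightarrow> real" where
  "bip_value \<alpha> m p = 6 * (1 / 4) powr (2 / \<alpha>) * (1 - (m - 1) / p) * p powr (2 - 2 / \<alpha>)"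

section \<open>Dependence on the part sizes\<close>

definition balanced_product :: "nat \<Rightarrow> nat" where
  "balanced_product n = (n div 2) * (n - n div 2)"

text \<open>With h = n div 2 and d = h - a, the balanced product exceeds a * b by d * (n - 2 * h) +
  d * d. Both terms are nonnegative, and equality forces d = 0.\<close>

lemma mult_le_balanced_product_aux:
  fixes a b n :: nat
  assumes "a + b = n" "a \<le> b"
  shows "a * b \<le> balanced_product n" "a * b = balanced_product n \<Longrightarrow> a = n div 2"
proof -
  define h where "h = n div 2"
  have "a \<le> h" "2 * h \<le> n" using assms by (auto simp: h_def)
  define d where "d = int h - int a"
  have d: "0 \<le> d" using \<open>a \<le> h\<close> by (simp add: d_def)
  have "int (balanced_product n) = int h * (int n - int h)"
    using \<open>2 * h \<le> n\<close> by (simp add: balanced_product_def h_def of_nat_diff)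
  also have "\<dots> = int a * int b + d * (int n - 2 * int h) + d * d"
    using assms by (simp add: d_def algebra_simps flip: assms(1))
  finally have eq: "int (balanced_product n) = int (a * b) + d * (int n - 2 * int h) + d * d" by simp
  have nn: "0 \<le> d * (int n - 2 * int h)" "0 \<le> d * d" using d \<open>2 * h \<le> n\<close> by auto
  show "a * b \<le> balanced_product n" using eq nn by linarith
  show "a = n div 2" if "a * b = balanced_product n"
  proof -
    have "d * d = 0" using eq nn that by linarith
    then show ?thesis by (simp add: d_def h_def)
  qed
qed

lemma mult_le_balanced_product:
  fixes a b n :: nat
  assumes "a + b = n"
  shows "a * b \<le> balanced_product n"
    and "a * b = balanced_product n \<Longrightarrow> a = n div 2 \<or> b = n div 2"
proof -
  have "a * b \<le> balanced_product n \<and> (a * b = balanced_product n \<longrightarrow> a = n div 2 \<or> b = n div 2)"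
  proof (cases "a \<le> b")
    case True
    then show ?thesis using mult_le_balanced_product_aux[OF assms] by blast
  next
    case False
    then have "b + a = n" "b \<le> a" using assms by auto
    from mult_le_balanced_product_aux[OF this] show ?thesis by (simp add: mult.commute)
  qed
  then show "a * b \<le> balanced_product n"
    "a * b = balanced_product n \<Longrightarrow> a = n div 2 \<or> b = n div 2" by blast+
qed

lemma balanced_product_bounds:
  "(real n)\<^sup>2 - 1 \<le> 4 * real (balanced_product n)" "4 * real (balanced_product n) \<le> (real n)\<^sup>2"
proof -
  obtain h where "n = 2 * h \<or> n = 2 * h + 1" by (metis evenE oddE)
  then show "(real n)\<^sup>2 - 1 \<le> 4 * real (balanced_product n)" 
    "4 * real (balanced_product n) \<le> (real n)\<^sup>2"
    by (auto simp: balanced_product_def power2_eq_square algebra_simps)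
qed

text \<open>By Cauchy-Schwarz the subtracted sum of squares is at least S^2 / a, which yields the
  Maclaurin factor 1 - 1/a; the power mean inequality then bounds S.\<close>

lemma sum_prod_two_subsets_le:
  fixes x :: "'a \<Rightarrow> real"
  assumes fin: "finite A" and ne: "A \<noteq> {}" and x: "\<And>v. 0 \<le> x v" and \<alpha>: "\<alpha> \<ge> 1"
  shows "2 * (\<Sum>T\<in>two_subsets A. \<Prod>v\<in>T. x v) \<le>
    (1 - 1 / real (card A)) * (real (card A) powr (2 - 2 / \<alpha>) * (\<Sum>v\<in>A. x v powr \<alpha>) powr (2 / \<alpha>))"
proof -
  define a where "a = real (card A)"
  define S where "S = (\<Sum>v\<in>A. x v)"
  have a: "1 \<le> a" using fin ne by (simp add: a_def Suc_le_eq card_gt_0_iff)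
  have "S\<^sup>2 \<le> (\<Sum>v\<in>A. (x v)\<^sup>2) * a"
    unfolding S_def a_def by (rule sum_squared_le_sum_of_squares)
  then have le: "2 * (\<Sum>T\<in>two_subsets A. \<Prod>v\<in>T. x v) \<le> (1 - 1 / a) * S\<^sup>2"
    using a by (simp add: sum_prod_two_subsets[OF fin] S_def field_simps)
  have sq: "(t powr r)\<^sup>2 = t powr (2 * r)" for t r :: real
    by (simp add: power2_eq_square flip: powr_add)
  have "S\<^sup>2 \<le> (a powr (1 - 1 / \<alpha>) * (\<Sum>v\<in>A. x v powr \<alpha>) powr (1 / \<alpha>))\<^sup>2"
    unfolding S_def a_def using sum_le_card_powr_mult_powr[OF fin _ \<alpha>, of x] x
    by (intro power_mono) (auto intro: sum_nonneg)
  also have "\<dots> = a powr (2 - 2 / \<alpha>) * (\<Sum>v\<in>A. x v powr \<alpha>) powr (2 / \<alpha>)"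
    unfolding power_mult_distrib sq by (simp add: algebra_simps)
  finally have "(1 - 1 / a) * S\<^sup>2 \<le> (1 - 1 / a) * (a powr (2 - 2 / \<alpha>) * (\<Sum>v\<in>A. x v powr \<alpha>) powr (2 / \<alpha>))"
    using a by (intro mult_left_mono) auto
  with le show ?thesis unfolding a_def by (rule order_trans)
qed

text \<open>The sum factors over the parts, and each factor is bounded through the share
  \<open>c\<close> or \<open>d\<close> of the power sum carried by its part. From c + d = 1 follows
  c * d \<le> 1/4.\<close>

lemma sum_prod_complete22_le:
  fixes x :: "'a \<Rightarrow> real"
  assumes fin: "finite A" "finite B" and dj: "A \<inter> B = {}" and x: "\<And>v. 0 \<le> x v" and \<alpha>: "\<alpha> \<ge> 1"
    and nrm: "(\<Sum>v\<in>A \<union> B. x v powr \<alpha>) = 1"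
  shows "24 * (\<Sum>e\<in>complete22 A B. \<Prod>v\<in>e. x v)
    \<le> bip_value \<alpha> (real (card (A \<union> B))) (real (card A * card B))"
proof (cases "A = {} \<or> B = {}")
  \<comment> \<open>With an empty part the product p is 0, and so is \<open>bip_value\<close>: its
    factor \<open>0 powr _\<close> is 0, whatever the division by p yields.\<close>
  case True
  have "two_subsets {} = ({} :: 'a set set)" by (auto simp: two_subsets_def)
  with True show ?thesis
    unfolding sum_prod_complete22[OF fin dj] by (auto simp: bip_value_def)
next
  case False
  define a where "a = real (card A)"
  define b where "b = real (card B)"
  define c where "c = (\<Sum>v\<in>A. x v powr \<alpha>)"
  define d where "d = (\<Sum>v\<in>B. x v powr \<alpha>)"
  have a: "1 \<le> a" and b: "1 \<le> b"
    using fin False by (simp_all add: a_def b_def Suc_le_eq card_gt_0_iff)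
  have cd: "0 \<le> c" "0 \<le> d" by (auto simp: c_def d_def intro: sum_nonneg)
  have "c + d = 1" using nrm fin dj by (simp add: c_def d_def sum.union_disjoint)
  then have "d = 1 - c" by simp
  then have "c * d \<le> 1 / 4"
    using zero_le_power2[of "c - 1 / 2"]
    unfolding \<open>d = 1 - c\<close> by (simp add: power2_eq_square algebra_simps)
  then have cd4: "c powr (2 / \<alpha>) * d powr (2 / \<alpha>) \<le> (1 / 4) powr (2 / \<alpha>)"
    using cd \<alpha> by (subst powr_mult[symmetric]) (auto intro: powr_mono2)
  have "24 * (\<Sum>e\<in>complete22 A B. \<Prod>v\<in>e. x v)
      = 6 * ((2 * (\<Sum>T\<in>two_subsets A. \<Prod>v\<in>T. x v)) * (2 * (\<Sum>T\<in>two_subsets B. \<Prod>v\<in>T. x v)))"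
    unfolding sum_prod_complete22[OF fin dj] by simp
  also have "\<dots> \<le> 6 * (((1 - 1 / a) * (a powr (2 - 2 / \<alpha>) * c powr (2 / \<alpha>)))
      * ((1 - 1 / b) * (b powr (2 - 2 / \<alpha>) * d powr (2 / \<alpha>))))"
  proof (rule mult_left_mono[OF mult_mono])
    show "2 * (\<Sum>T\<in>two_subsets A. \<Prod>v\<in>T. x v) \<le> (1 - 1 / a) * (a powr (2 - 2 / \<alpha>) * c powr (2 / \<alpha>))"
      unfolding a_def c_def by (rule sum_prod_two_subsets_le) (use fin False x \<alpha> in auto)
    show "2 * (\<Sum>T\<in>two_subsets B. \<Prod>v\<in>T. x v) \<le> (1 - 1 / b) * (b powr (2 - 2 / \<alpha>) * d powr (2 / \<alpha>))"
      unfolding b_def d_def by (rule sum_prod_two_subsets_le) (use fin False x \<alpha> in auto)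
    show "0 \<le> (1 - 1 / a) * (a powr (2 - 2 / \<alpha>) * c powr (2 / \<alpha>))" using a by simp
    show "0 \<le> 2 * (\<Sum>T\<in>two_subsets B. \<Prod>v\<in>T. x v)"
      using x by (simp add: sum_nonneg prod_nonneg)
  qed simp
  also have "\<dots> = 6 * ((1 - 1 / a) * (1 - 1 / b) * (a * b) powr (2 - 2 / \<alpha>)) * (c powr (2 / \<alpha>) * d powr (2 / \<alpha>))"
    using a b by (simp add: powr_mult mult_ac)
  also have "\<dots> \<le> 6 * ((1 - 1 / a) * (1 - 1 / b) * (a * b) powr (2 - 2 / \<alpha>)) * (1 / 4) powr (2 / \<alpha>)"
    by (intro mult_left_mono cd4) (use a b in auto)
  also have "(1 - 1 / a) * (1 - 1 / b) = 1 - (a + b - 1) / (a * b)"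
    using a b by (simp add: field_simps)
  finally show ?thesis
    using fin dj by (simp add: bip_value_def a_def b_def card_Un_disjoint mult_ac)
qed

text \<open>Both factors depending on p grow with p, the power strictly. As m - 1 < q, the other
  factor is positive at q, so strictness survives; at p = 0 the value is 0.\<close>

lemma bip_value_strict_mono:
  assumes \<alpha>: "\<alpha> > 1" and m: "1 \<le> m" and p: "0 \<le> p" "p = 0 \<or> m - 1 \<le> p" "p < q" and q: "m - 1 < q"
  shows "bip_value \<alpha> m p < bip_value \<alpha> m q"
proof -
  have q0: "0 < q" using p by simp
  have \<sigma>: "0 < 2 - 2 / \<alpha>" using \<alpha> by (simp add: field_simps)
  have pos: "0 < 1 - (m - 1) / q" using q q0 by simp
  have "(1 - (m - 1) / p) * p powr (2 - 2 / \<alpha>) < (1 - (m - 1) / q) * q powr (2 - 2 / \<alpha>)"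
  proof (cases "p = 0")
    case True
    then show ?thesis using pos q0 by simp
  next
    case False
    then have p0: "0 < p" using p by simp
    have "(m - 1) / q \<le> (m - 1) / p"
      using m p p0 by (intro divide_left_mono) auto
    then have "(1 - (m - 1) / p) * p powr (2 - 2 / \<alpha>) \<le> (1 - (m - 1) / q) * p powr (2 - 2 / \<alpha>)"
      by (intro mult_right_mono) auto
    also have "\<dots> < (1 - (m - 1) / q) * q powr (2 - 2 / \<alpha>)"
      using pos p \<sigma> by (intro mult_strict_left_mono powr_less_mono2) auto
    finally show ?thesis .
  qed
  then show ?thesis by (simp add: bip_value_def mult.assoc)
qed

lemma card_edges_complete22:
  assumes "finite A" "finite B" "A \<inter> B = {}"
  shows "4 * real (card (complete22 A B))
    = (real (card A) * (real (card A) - 1)) * (real (card B) * (real (card B) - 1))"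
proof -
  have "2 * real (card (two_subsets X)) = real (card X) * (real (card X) - 1)"
    if "finite X" for X :: "'a set"
    using sum_prod_two_subsets[OF that, of "\<lambda>_. 1"] by (simp add: power2_eq_square algebra_simps)
  note this[OF assms(1)] this[OF assms(2)]
  moreover have "4 * real (card (complete22 A B))
      = (2 * real (card (two_subsets A))) * (2 * real (card (two_subsets B)))"
    using sum_prod_complete22[OF assms, of "\<lambda>_. 1"] by simp
  ultimately show ?thesis by simp
qed

lemma finite_complete22: "finite A \<Longrightarrow> finite B \<Longrightarrow> finite (complete22 A B)"
  by (rule finite_subset[of _ "Pow (A \<union> B)"]) (auto simp: complete22_def)

lemma lambda_spec_le_bip_value:
  assumes H: "kgraph 4 H" and ne: "verts H \<noteq> {}" and \<alpha>: "\<alpha> \<ge> 1"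
    and AB: "A \<inter> B = {}" "A \<union> B = verts H" "edges H \<subseteq> complete22 A B"
  shows "lambda_spec 4 \<alpha> H \<le> bip_value \<alpha> (real (card (verts H))) (real (card A * card B))"
proof -
  have fin: "finite A" "finite B" using H AB(2) by (auto simp: kgraph_def intro: finite_subset)
  obtain x where x: "\<And>v. 0 \<le> x v" "(\<Sum>v\<in>verts H. x v powr \<alpha>) = 1" "lagr 4 H x = lambda_spec 4 \<alpha> H"
    using lambda_spec_attained_nonneg[OF H ne, of \<alpha>] \<alpha> by auto
  have "lambda_spec 4 \<alpha> H = 24 * (\<Sum>e\<in>edges H. \<Prod>v\<in>e. x v)"
    using x(3) by (simp add: lagr_def fact_numeral)
  also have "\<dots> \<le> 24 * (\<Sum>e\<in>complete22 A B. \<Prod>v\<in>e. x v)"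
    using AB(3) x(1) finite_complete22[OF fin]
    by (intro mult_left_mono sum_mono2) (auto intro: prod_nonneg)
  also have "\<dots> \<le> bip_value \<alpha> (real (card (verts H))) (real (card A * card B))"
    using sum_prod_complete22_le[OF fin AB(1) x(1) \<alpha>] x(2) AB(2) by simp
  finally show ?thesis .
qed

lemma bip_value_le_balanced:
  fixes a b n :: nat
  assumes \<alpha>: "\<alpha> > 1" and n: "n \<ge> 4" and ab: "a + b = n"
  shows "bip_value \<alpha> (real n) (real (a * b)) \<le> bip_value \<alpha> (real n) (real (balanced_product n))"
    and "a \<noteq> n div 2 \<Longrightarrow> b \<noteq> n div 2 \<Longrightarrow>
      bip_value \<alpha> (real n) (real (a * b)) < bip_value \<alpha> (real n) (real (balanced_product n))"
proof -
  \<comment> \<open>The balanced product is at least (n^2 - 1) / 4, which exceeds n - 1 once n^2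
    \<ge> 4 n.\<close>
  have "real n * 4 \<le> real n * real n" using n by (intro mult_left_mono) auto
  then have q: "real n - 1 < real (balanced_product n)"
    using balanced_product_bounds(1)[of n] n unfolding power2_eq_square by linarith
  \<comment> \<open>For positive sizes, (a - 1) (b - 1) \<ge> 0 rearranges to a b \<ge> n -
    1.\<close>
  have p: "real (a * b) = 0 \<or> real n - 1 \<le> real (a * b)"
  proof (cases "a = 0 \<or> b = 0")
    case False
    then obtain a' b' where "a = Suc a'" "b = Suc b'" by (metis not0_implies_Suc)
    then show ?thesis using ab by auto
  qed auto
  have strict: "bip_value \<alpha> (real n) (real (a * b)) < bip_value \<alpha> (real n) (real (balanced_product n))"
    if "a * b < balanced_product n"
    by (rule bip_value_strict_mono[OF \<alpha>]) (use n p q that in \<open>simp_all del: of_nat_mult\<close>)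
  show "bip_value \<alpha> (real n) (real (a * b)) \<le> bip_value \<alpha> (real n) (real (balanced_product n))"
    using strict mult_le_balanced_product(1)[OF ab] by (cases "a * b = balanced_product n") auto
  show "bip_value \<alpha> (real n) (real (a * b)) < bip_value \<alpha> (real n) (real (balanced_product n))"
    if "a \<noteq> n div 2" "b \<noteq> n div 2"
    using strict mult_le_balanced_product[OF ab] that by (metis le_neq_implies_less)
qed

text \<open>The lower bound uses weights that are constant on each part and give each part half of
  the power sum; these make every inequality behind the upper bound tight.\<close>

lemma lambda_spec_B4:
  assumes \<alpha>: "\<alpha> \<ge> 1" and n: "n \<ge> 2"
  shows "lambda_spec 4 \<alpha> (B4 n) = bip_value \<alpha> (real n) (real (balanced_product n))"
proof (rule antisym)
  let ?A = "{..<n div 2}" and ?B = "{n div 2..<n}"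
  have dj: "?A \<inter> ?B = {}" and un: "?A \<union> ?B = {..<n}" by auto
  have ne: "verts (B4 n) \<noteq> {}" using n by (auto simp: verts_B4 lessThan_empty_iff)
  have bp: "balanced_product n = card ?A * card ?B" by (simp add: balanced_product_def)
  show "lambda_spec 4 \<alpha> (B4 n) \<le> bip_value \<alpha> (real n) (real (balanced_product n))"
    using lambda_spec_le_bip_value[OF kgraph_B4 ne \<alpha> dj] un
    by (simp add: verts_B4 edges_B4 bp)
  define a where "a = real (n div 2)"
  define b where "b = real (n - n div 2)"
  have a: "0 < a" and b: "0 < b" and abn: "a + b = real n"
    using n by (auto simp: a_def b_def)
  define u where "u = (1 / (2 * a)) powr (1 / \<alpha>)"
  define w where "w = (1 / (2 * b)) powr (1 / \<alpha>)"
  define x where "x v = (if v < n div 2 then u else w)" for v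
  have uw: "u powr \<alpha> = 1 / (2 * a)" "w powr \<alpha> = 1 / (2 * b)" "0 \<le> u" "0 \<le> w"
    using a b \<alpha> by (simp_all add: u_def w_def powr_powr)
  have "(\<Sum>v\<in>verts (B4 n). \<bar>x v\<bar> powr \<alpha>) = (\<Sum>v\<in>?A. \<bar>x v\<bar> powr \<alpha>) + (\<Sum>v\<in>?B. \<bar>x v\<bar> powr \<alpha>)"
    unfolding verts_B4 un[symmetric] by (rule sum.union_disjoint) auto
  also have "\<dots> = a * (1 / (2 * a)) + b * (1 / (2 * b))"
    using uw by (simp add: x_def a_def b_def)
  also have "\<dots> = 1" using a b by simp
  finally have "lagr 4 (B4 n) x \<le> lambda_spec 4 \<alpha> (B4 n)"
    by (rule lagr_le_lambda_spec[OF kgraph_B4 ne, rotated]) (use \<alpha> in auto)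
  moreover have "lagr 4 (B4 n) x = 6 * ((a * (a - 1) * u\<^sup>2) * (b * (b - 1) * w\<^sup>2))"
  proof -
    have "2 * (\<Sum>T\<in>two_subsets ?A. \<Prod>v\<in>T. x v) = a * (a - 1) * u\<^sup>2"
      by (simp add: sum_prod_two_subsets x_def a_def power2_eq_square algebra_simps)
    moreover have "2 * (\<Sum>T\<in>two_subsets ?B. \<Prod>v\<in>T. x v) = b * (b - 1) * w\<^sup>2"
      by (simp add: sum_prod_two_subsets x_def b_def power2_eq_square algebra_simps)
    ultimately have "4 * (\<Sum>e\<in>complete22 ?A ?B. \<Prod>v\<in>e. x v) = (a * (a - 1) * u\<^sup>2) * (b * (b - 1) * w\<^sup>2)"
      by (simp add: sum_prod_complete22[OF _ _ dj] flip: \<open>_ = a * (a - 1) * u\<^sup>2\<close> \<open>_ = b * (b - 1) * w\<^sup>2\<close>)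
    then show ?thesis by (simp add: lagr_def edges_B4 fact_numeral)
  qed
  moreover have "6 * ((a * (a - 1) * u\<^sup>2) * (b * (b - 1) * w\<^sup>2)) = bip_value \<alpha> (real n) (a * b)"
  proof -
    have "u\<^sup>2 * w\<^sup>2 = (u * w) powr 2" using uw by (simp add: power_mult_distrib)
    also have "u * w = (1 / 4 * (1 / (a * b))) powr (1 / \<alpha>)"
      unfolding u_def w_def using a b by (subst powr_mult[symmetric]) (auto simp: field_simps)
    also have "\<dots> powr 2 = (1 / 4) powr (2 / \<alpha>) * (1 / (a * b)) powr (2 / \<alpha>)"
      using a b by (subst powr_mult) (auto simp: powr_powr powr_mult)
    also have "(1 / (a * b)) powr (2 / \<alpha>) = (a * b) powr (- 2 / \<alpha>)"
      using a b by (simp add: powr_divide powr_minus_divide)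
    finally have uw2: "u\<^sup>2 * w\<^sup>2 = (1 / 4) powr (2 / \<alpha>) * (a * b) powr (- 2 / \<alpha>)" .
    have "(a * b) powr (2 - 2 / \<alpha>) = (a * b) powr 2 * (a * b) powr (- 2 / \<alpha>)"
      by (simp flip: powr_add)
    then have ab: "(a * b) powr (2 - 2 / \<alpha>) = (a * b)\<^sup>2 * (a * b) powr (- 2 / \<alpha>)"
      using a b by simp
    have "bip_value \<alpha> (real n) (a * b)
        = 6 * ((1 - (a + b - 1) / (a * b)) * (a * b)\<^sup>2) * ((1 / 4) powr (2 / \<alpha>) * (a * b) powr (- 2 / \<alpha>))"
      by (simp add: bip_value_def ab abn)
    also have "(1 - (a + b - 1) / (a * b)) * (a * b)\<^sup>2 = a * (a - 1) * (b * (b - 1))"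
      using a b by (simp add: field_simps power2_eq_square)
    finally show ?thesis unfolding uw2[symmetric] by (simp add: mult_ac)
  qed
  moreover have "a * b = real (balanced_product n)" by (simp add: a_def b_def balanced_product_def)
  ultimately show "bip_value \<alpha> (real n) (real (balanced_product n)) \<le> lambda_spec 4 \<alpha> (B4 n)" by simp
qed

section \<open>Asymptotics\<close>

text \<open>Isolates the growth n^(4 - 4/\<alpha>); the other two variable factors tend to 1. The
  constant is 6/16, because the exponents of the two powers of 1/4 add up to 2.\<close>

lemma bip_value_balanced_eq:
  assumes n: "n \<ge> 2"
  shows "bip_value \<alpha> (real n) (real (balanced_product n))
    = 3 / 8 * (1 - (real n - 1) / real (balanced_product n))
      * (4 * real (balanced_product n) / (real n)\<^sup>2) powr (2 - 2 / \<alpha>) * real n powr (4 - 4 / \<alpha>)"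
proof -
  define p where "p = real (balanced_product n)"
  have "(2::real)\<^sup>2 \<le> (real n)\<^sup>2" using n by (intro power_mono) auto
  then have p: "0 < p" using balanced_product_bounds(1)[of n] by (simp add: p_def)
  have "p = 1 / 4 * (4 * p / (real n)\<^sup>2 * (real n)\<^sup>2)" using n by simp
  also have "\<dots> powr (2 - 2 / \<alpha>) = (1 / 4) powr (2 - 2 / \<alpha>)
      * ((4 * p / (real n)\<^sup>2) powr (2 - 2 / \<alpha>) * (real n)\<^sup>2 powr (2 - 2 / \<alpha>))"
    using p by (simp only: powr_mult)
  also have "(real n)\<^sup>2 powr (2 - 2 / \<alpha>) = real n powr (4 - 4 / \<alpha>)"
    using n by (simp add: powr_powr algebra_simps flip: powr_numeral)
  finally have pw: "p powr (2 - 2 / \<alpha>) = (1 / 4) powr (2 - 2 / \<alpha>)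
      * ((4 * p / (real n)\<^sup>2) powr (2 - 2 / \<alpha>) * real n powr (4 - 4 / \<alpha>))" .
  have "(1 / 4) powr (2 / \<alpha>) * (1 / 4) powr (2 - 2 / \<alpha>) = ((1 / 4 :: real) powr 2)"
    by (simp flip: powr_add)
  also have "\<dots> = 1 / 16" by (simp add: power2_eq_square)
  finally have q: "(1 / 4) powr (2 / \<alpha>) * (1 / 4) powr (2 - 2 / \<alpha>) = (1 / 16 :: real)" .
  have "bip_value \<alpha> (real n) p = 6 * ((1 / 4) powr (2 / \<alpha>) * (1 / 4) powr (2 - 2 / \<alpha>)) * (1 - (real n - 1) / p)
      * ((4 * p / (real n)\<^sup>2) powr (2 - 2 / \<alpha>) * real n powr (4 - 4 / \<alpha>))"
    unfolding bip_value_def pw by (simp only: mult_ac)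
  then show ?thesis unfolding q by (simp add: p_def mult_ac)
qed

lemma balanced_ratio_bounds:
  assumes "n \<ge> 1"
  shows "1 - 1 / (real n)\<^sup>2 \<le> 4 * real (balanced_product n) / (real n)\<^sup>2"
    and "4 * real (balanced_product n) / (real n)\<^sup>2 \<le> 1"
proof -
  have n: "0 < (real n)\<^sup>2" using assms by simp
  have "1 - 1 / (real n)\<^sup>2 = ((real n)\<^sup>2 - 1) / (real n)\<^sup>2" using n by (simp add: diff_divide_distrib)
  also have "\<dots> \<le> 4 * real (balanced_product n) / (real n)\<^sup>2"
    using balanced_product_bounds(1)[of n] by (intro divide_right_mono) auto
  finally show "1 - 1 / (real n)\<^sup>2 \<le> 4 * real (balanced_product n) / (real n)\<^sup>2" .
  show "4 * real (balanced_product n) / (real n)\<^sup>2 \<le> 1"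
    using balanced_product_bounds(2)[of n] n by simp
qed

text \<open>The factor is the product of 1 - 1/a and 1 - 1/b over the two balanced part sizes, and
  both sizes grow weakly.\<close>

lemma balanced_factor_mono:
  assumes "2 \<le> m" "m \<le> n"
  shows "1 - (real m - 1) / real (balanced_product m) \<le> 1 - (real n - 1) / real (balanced_product n)"
proof -
  have eq: "1 - (real k - 1) / real (balanced_product k) = (1 - 1 / real (k div 2)) * (1 - 1 / real (k - k div 2))"
    if "2 \<le> k" for k :: nat
  proof -
    define a where "a = real (k div 2)"
    define b where "b = real (k - k div 2)"
    have "real k = a + b" "0 < a" "0 < b" using that by (auto simp: a_def b_def)
    moreover have "real (balanced_product k) = a * b" by (simp add: balanced_product_def a_def b_def)
    ultimately show ?thesis unfolding a_def[symmetric] b_def[symmetric] by (simp add: field_simps)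
  qed
  have "m div 2 \<le> n div 2" "m - m div 2 \<le> n - n div 2" "1 \<le> m div 2" "1 \<le> m - m div 2"
    using assms by auto
  then have "1 - 1 / real (m div 2) \<le> 1 - 1 / real (n div 2)"
    "1 - 1 / real (m - m div 2) \<le> 1 - 1 / real (n - n div 2)"
    "0 \<le> 1 - 1 / real (n div 2)" "0 \<le> 1 - 1 / real (m - m div 2)"
    by (simp_all add: frac_le del: of_nat_diff)
  then show ?thesis using assms by (simp only: eq) (intro mult_mono; simp)
qed

text \<open>The scaled value is 3/8 times r(n) q(n)^\<sigma> n^c with r nondecreasing. Parity makes
  q fluctuate, but only between 1 - 1/n^2 and 1, a relative loss of order 1/n^2; passing from m < n
  to n, the power n^c gains a factor of at least (1 - 1/n)^(-c), which is of order c/n and wins for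
  large n.\<close>

lemma bip_value_scaled_strict_mono:
  assumes \<alpha>: "\<alpha> > 1" and c: "c > 0"
  shows "\<exists>M\<ge>4. \<forall>m\<ge>M. \<forall>n>m.
    bip_value \<alpha> (real m) (real (balanced_product m)) * real m powr - (4 - 4 / \<alpha> - c)
    < bip_value \<alpha> (real n) (real (balanced_product n)) * real n powr - (4 - 4 / \<alpha> - c)"
proof -
  define \<sigma> where "\<sigma> = 2 - 2 / \<alpha>"
  have \<sigma>: "0 < \<sigma>" using \<alpha> by (simp add: \<sigma>_def field_simps)
  define r where "r n = 1 - (real n - 1) / real (balanced_product n)" for n
  define q where "q n = 4 * real (balanced_product n) / (real n)\<^sup>2" for n
  have val: "bip_value \<alpha> (real n) (real (balanced_product n)) * real n powr - (4 - 4 / \<alpha> - c)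
      = 3 / 8 * (r n * (q n powr \<sigma> * real n powr c))" if "n \<ge> 2" for n
  proof -
    have "real n powr (4 - 4 / \<alpha>) * real n powr - (4 - 4 / \<alpha> - c) = real n powr c"
      by (simp flip: powr_add)
    then show ?thesis
      unfolding bip_value_balanced_eq[OF that] by (simp add: r_def q_def \<sigma>_def mult.assoc)
  qed
  have "eventually (\<lambda>n. (1 - 1 / real n) powr c < (1 - 1 / (real n)\<^sup>2) powr \<sigma>) sequentially"
    using c \<sigma> by real_asymp
  then obtain N where N: "\<And>n. n \<ge> N \<Longrightarrow> (1 - 1 / real n) powr c < (1 - 1 / (real n)\<^sup>2) powr \<sigma>"
    by (auto simp: eventually_sequentially)
  define M where "M = max N 4"
  have "3 / 8 * (r m * (q m powr \<sigma> * real m powr c)) < 3 / 8 * (r n * (q n powr \<sigma> * real n powr c))"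
    if mn: "M \<le> m" "m < n" for m n
  proof -
    have m: "4 \<le> m" "N \<le> n" "4 \<le> n" using mn by (auto simp: M_def)
    have rn: "0 < r n"
    proof -
      have "real n * 4 \<le> real n * real n" using m by (intro mult_left_mono) auto
      then have "real n - 1 < real (balanced_product n)"
        using balanced_product_bounds(1)[of n] m unfolding power2_eq_square by linarith
      then show ?thesis using m by (simp add: r_def field_simps)
    qed
    have rmn: "r m \<le> r n" unfolding r_def using m mn by (intro balanced_factor_mono) auto
    have "q m powr \<sigma> \<le> 1"
      using balanced_ratio_bounds(2)[of m] m \<sigma> by (intro powr_le1) (auto simp: q_def)
    then have "q m powr \<sigma> * real m powr c \<le> real m powr c" by (simp add: mult_left_le_one_le)
    also have "\<dots> = (real m / real n) powr c * real n powr c"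
      using m by (simp add: powr_divide)
    also have "\<dots> \<le> (1 - 1 / real n) powr c * real n powr c"
    proof (intro mult_right_mono powr_mono2)
      show "real m / real n \<le> 1 - 1 / real n" using mn m by (simp add: field_simps)
    qed (use c in auto)
    also have "\<dots> < (1 - 1 / (real n)\<^sup>2) powr \<sigma> * real n powr c"
      using N[OF m(2)] m by (intro mult_strict_right_mono) auto
    also have "\<dots> \<le> q n powr \<sigma> * real n powr c"
    proof (intro mult_right_mono powr_mono2)
      show "1 - 1 / (real n)\<^sup>2 \<le> q n"
        unfolding q_def using m by (intro balanced_ratio_bounds) auto
      show "0 \<le> 1 - 1 / (real n)\<^sup>2" using m by simp
    qed (use \<sigma> in auto)
    finally have "q m powr \<sigma> * real m powr c < q n powr \<sigma> * real n powr c" .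
    then have "r n * (q m powr \<sigma> * real m powr c) < r n * (q n powr \<sigma> * real n powr c)"
      using rn by (intro mult_strict_left_mono)
    moreover have "r m * (q m powr \<sigma> * real m powr c) \<le> r n * (q m powr \<sigma> * real m powr c)"
      using rmn by (intro mult_right_mono) auto
    ultimately show ?thesis by linarith
  qed
  moreover have "M \<ge> 4" by (simp add: M_def)
  moreover have "2 \<le> m" "2 \<le> n" if "M \<le> m" "m < n" for m n
    using that by (auto simp: M_def)
  ultimately show ?thesis
    by (intro exI[of _ M] conjI allI impI) (simp_all only: val)
qed

lemma bip_value_balanced_asymp_lower:
  assumes \<alpha>: "\<alpha> > 1" and \<eta>: "\<eta> > 0"
  shows "eventually (\<lambda>n. 3 / 8 * (1 - \<eta>) * real n powr (4 - 4 / \<alpha>)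
    \<le> bip_value \<alpha> (real n) (real (balanced_product n))) sequentially"
proof -
  define \<sigma> where "\<sigma> = 2 - 2 / \<alpha>"
  have \<sigma>: "0 < \<sigma>" using \<alpha> by (simp add: \<sigma>_def field_simps)
  \<comment> \<open>Putting the lower bound (n^2 - 1) / 4 for the balanced product into both factors
    leaves an explicit function of n.\<close>
  have "((\<lambda>n. (1 - 4 * (real n - 1) / ((real n)\<^sup>2 - 1)) * (1 - 1 / (real n)\<^sup>2) powr \<sigma>) \<longlongrightarrow> 1) sequentially"
    using \<sigma> by real_asymp
  then have "eventually (\<lambda>n. 1 - \<eta> < (1 - 4 * (real n - 1) / ((real n)\<^sup>2 - 1)) * (1 - 1 / (real n)\<^sup>2) powr \<sigma>) sequentially"
    by (rule order_tendstoD) (use \<eta> in auto)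
  moreover have "eventually (\<lambda>n::nat. n \<ge> 4) sequentially" by (rule eventually_ge_at_top)
  ultimately show ?thesis
  proof eventually_elim
    case (elim n)
    define p where "p = real (balanced_product n)"
    have n2: "16 \<le> (real n)\<^sup>2" using power_mono[of 4 "real n" 2] elim by simp
    have p: "(real n)\<^sup>2 - 1 \<le> 4 * p" using balanced_product_bounds(1)[of n] by (simp add: p_def)
    have "(real n - 1) / p \<le> 4 * (real n - 1) / ((real n)\<^sup>2 - 1)"
    proof -
      have "4 * (real n - 1) / (4 * p) \<le> 4 * (real n - 1) / ((real n)\<^sup>2 - 1)"
        using p n2 elim by (intro divide_left_mono) auto
      moreover have "4 * (real n - 1) / (4 * p) = (real n - 1) / p" by (rule mult_divide_mult_cancel_left) simp
      ultimately show ?thesis by simp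
    qed
    moreover have "4 * (real n - 1) / ((real n)\<^sup>2 - 1) \<le> 1"
    proof -
      have "4 * real n \<le> real n * real n" using elim by (intro mult_right_mono) auto
      then show ?thesis using n2 by (simp add: power2_eq_square)
    qed
    moreover have "(1 - 1 / (real n)\<^sup>2) powr \<sigma> \<le> (4 * p / (real n)\<^sup>2) powr \<sigma>"
      unfolding p_def using elim \<sigma> n2 by (intro powr_mono2 balanced_ratio_bounds) auto
    ultimately have "1 - \<eta> \<le> (1 - (real n - 1) / p) * (4 * p / (real n)\<^sup>2) powr \<sigma>"
      using elim(1) by (intro order_trans[OF less_imp_le[OF elim(1)]] mult_mono) auto
    then have "3 / 8 * (1 - \<eta>) * real n powr (4 - 4 / \<alpha>)
        \<le> 3 / 8 * ((1 - (real n - 1) / p) * (4 * p / (real n)\<^sup>2) powr \<sigma>) * real n powr (4 - 4 / \<alpha>)"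
      by (intro mult_right_mono mult_left_mono) auto
    moreover have "2 \<le> n" using elim by simp
    ultimately show ?case
      unfolding p_def \<sigma>_def by (simp only: bip_value_balanced_eq mult.assoc)
  qed
qed

text \<open>To first order in logarithms the claim reads (4 - \<tau>) t < s/m, where s = (4 -
  \<tau>) (1 - \<delta>/2) is the exponent in the statement. The left side is at most (4 - \<tau>)
  (1 - \<delta>) / m = (s - c) / m, so c/m remains to absorb the second-order error.\<close>

lemma deletion_factor_less:
  assumes \<tau>: "0 < \<tau>" "\<tau> < 4" and \<delta>: "0 < \<delta>" "\<delta> < 1"
  shows "\<exists>M. \<forall>m\<ge>M. \<forall>t. 0 \<le> t \<longrightarrow> t \<le> (1 - \<delta>) / real m \<longrightarrow>
    (1 - t) powr \<tau> * (1 - 1 / real m) powr (4 - \<tau> - (4 - \<tau>) * \<delta> / 2) < 1 - 4 * t"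
proof -
  define c where "c = (4 - \<tau>) * \<delta> / 2"
  define s where "s = 4 - \<tau> - c"
  have c: "0 < c" using \<tau> \<delta> by (simp add: c_def)
  have "s = (4 - \<tau>) * (1 - \<delta> / 2)" by (simp add: s_def c_def field_simps)
  then have s: "0 < s" using \<tau> \<delta> by simp
  have "(1 - t) powr \<tau> * (1 - 1 / real m) powr s < 1 - 4 * t"
    \<comment> \<open>The bound 32/c makes the error 32 t^2 \<le> 32/m^2 smaller than c/m; the
      summand 9 gives 4 t < 1/2, the range of the quadratic lower bound for the logarithm.\<close>
    if m: "nat \<lceil>32 / c\<rceil> + 9 \<le> m" and t: "0 \<le> t" "t \<le> (1 - \<delta>) / real m" for m t
  proof -
    have m0: "8 < real m" and mc: "32 / c < real m" using m c by linarith+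
    have tm: "t \<le> 1 / real m"
      using \<delta> m0 by (intro order_trans[OF t(2)] divide_right_mono) auto
    have "1 / real m < 1 / 8" using m0 by (intro divide_strict_left_mono) auto
    then have t8: "t < 1 / 8" using tm by linarith
    have "32 * t * t \<le> 32 * (1 / real m) * (1 / real m)"
      using tm t by (intro mult_mono) auto
    also have "\<dots> < c / real m"
    proof -
      have "32 / real m < c" using mc c m0 by (simp add: field_simps)
      then have "32 / real m / real m < c / real m" using m0 by (intro divide_strict_right_mono) auto
      then show ?thesis by simp
    qed
    finally have t2: "32 * t * t < c / real m" .
    have "(4 - \<tau>) * t \<le> (4 - \<tau>) * ((1 - \<delta>) / real m)"
      using \<tau> t by (intro mult_left_mono) auto
    also have "\<dots> = (4 - \<tau>) * (1 - \<delta>) / real m" by simp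
    also have "(4 - \<tau>) * (1 - \<delta>) = s - c" by (simp add: s_def c_def field_simps)
    finally have "(4 - \<tau>) * t + 32 * t * t < s / real m" using t2 by (simp add: diff_divide_distrib)
    then have e: "- t * \<tau> + - (1 / real m) * s < - (4 * t) - 2 * (4 * t)\<^sup>2"
      by (simp add: power2_eq_square algebra_simps)
    have "1 - t \<le> exp (- t)" "1 - 1 / real m \<le> exp (- (1 / real m))"
      using exp_ge_add_one_self[of "- t"] exp_ge_add_one_self[of "- (1 / real m)"] by simp_all
    then have "(1 - t) powr \<tau> * (1 - 1 / real m) powr s
        \<le> exp (- t) powr \<tau> * exp (- (1 / real m)) powr s"
      using t8 m0 \<tau> s by (intro mult_mono powr_mono2) auto
    also have "\<dots> = exp (- t * \<tau> + - (1 / real m) * s)"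
      by (simp add: powr_def mult_ac flip: exp_add)
    also have "\<dots> < exp (- (4 * t) - 2 * (4 * t)\<^sup>2)" using e by simp
    also have "\<dots> \<le> exp (ln (1 - 4 * t))"
      unfolding exp_le_cancel_iff using t t8 by (intro ln_one_minus_pos_lower_bound) auto
    also have "\<dots> = 1 - 4 * t" using t8 by simp
    finally show ?thesis .
  qed
  then show ?thesis unfolding s_def c_def by blast
qed

section \<open>Minimum degree from nearly uniform weights\<close>

text \<open>All weights are at least \<open>l\<close>, close to the uniform weight \<open>u\<close>,
  while their sum is at most m u. Hence a link sum exceeds degree times u^3 by at most 3 \<delta>
  m^3 u^3. The Lagrange condition bounds it below by about m^3 u^3 / 16, and u^3 cancels.\<close>

lemma min_degree_ge_of_heavy_vertices:
  assumes H: "kgraph 4 H" and ne: "verts H \<noteq> {}" and \<alpha>: "\<alpha> > 1"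
    and x: "\<And>v. 0 \<le> x v" "(\<Sum>v\<in>verts H. x v powr \<alpha>) = 1" "lagr 4 H x = lambda_spec 4 \<alpha> H"
    and heavy: "\<And>v. v \<in> verts H \<Longrightarrow> (1 - \<delta>) / real (card (verts H)) \<le> x v powr \<alpha>"
    and \<delta>: "0 \<le> \<delta>" "\<delta> < 1" and \<eta>: "\<eta> \<le> 1"
    and lam: "3 / 8 * (1 - \<eta>) * real (card (verts H)) powr (4 - 4 / \<alpha>) \<le> lambda_spec 4 \<alpha> H"
  shows "((1 - \<eta>) * (1 - \<delta>) / 16 - 3 * \<delta>) * real (card (verts H)) ^ 3 \<le> real (min_degree H)"
proof -
  define m where "m = real (card (verts H))"
  define u where "u = m powr (- 1 / \<alpha>)"
  define l where "l = (1 - \<delta>) powr (1 / \<alpha>) * u"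
  have fin: "finite (verts H)" using H by (simp add: kgraph_def)
  have m: "0 < m" using fin ne by (simp add: m_def card_gt_0_iff)
  have u: "0 < u" using m by (simp add: u_def)
  have l0: "0 < l" using \<delta> u by (simp add: l_def)
  have le1: "1 - \<delta> \<le> (1 - \<delta>) powr r" if "r \<le> 1" for r
    using powr_mono'[of r 1 "1 - \<delta>"] \<delta> that by simp
  have lu: "l \<le> u"
    using \<delta> u \<alpha> by (auto simp: l_def intro!: mult_left_le_one_le powr_le1)
  have xl: "l \<le> x v" if v: "v \<in> verts H" for v
  proof -
    have "l = ((1 - \<delta>) / m) powr (1 / \<alpha>)"
      using \<delta> m by (simp add: l_def u_def powr_divide powr_minus_divide)
    also have "\<dots> \<le> (x v powr \<alpha>) powr (1 / \<alpha>)"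
      using heavy[OF v] \<delta> m \<alpha> by (intro powr_mono2) (auto simp: m_def)
    also have "\<dots> = x v" using x(1)[of v] \<alpha> by (simp add: powr_powr)
    finally show ?thesis .
  qed
  have mu: "m powr (1 - 1 / \<alpha>) = m * u"
    using m powr_add[of m 1 "- 1 / \<alpha>"] by (simp add: u_def)
  have Sx: "(\<Sum>v\<in>verts H. x v) \<le> m * u"
    using sum_le_card_powr_mult_powr[OF fin, of x \<alpha>] x(1,2) \<alpha>
    unfolding mu[symmetric] by (simp add: m_def)
  have l3: "(1 - 3 * \<delta>) * u ^ 3 \<le> l ^ 3"
  proof -
    have "(1 - 3 * \<delta>) * u ^ 3 \<le> (1 - \<delta>) ^ 3 * u ^ 3"
      using Bernoulli_inequality[of "- \<delta>" 3] \<delta> u by (intro mult_right_mono) auto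
    also have "\<dots> = ((1 - \<delta>) * u) ^ 3" by (simp add: power_mult_distrib)
    also have "\<dots> \<le> l ^ 3"
      unfolding l_def using le1[of "1 / \<alpha>"] \<alpha> \<delta> u by (intro power_mono mult_right_mono) auto
    finally show ?thesis .
  qed
  have deg: "((1 - \<eta>) * (1 - \<delta>) / 16 - 3 * \<delta>) * m ^ 3 \<le> real (degree H v)" if v: "v \<in> verts H" for v
  proof -
    define E where "E = {e \<in> edges H. v \<in> e}"
    define S where "S = (\<Sum>e\<in>E. \<Prod>w\<in>e - {v}. x w)"
    have inj: "inj_on (\<lambda>e. e - {v}) E" by (auto simp: inj_on_def E_def)
    have mem: "e' \<subseteq> verts H \<and> card e' = 3" if e': "e' \<in> (\<lambda>e. e - {v}) ` E" for e'
    proof -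
      obtain e where e: "e' = e - {v}" "e \<in> edges H" "v \<in> e" using e' by (auto simp: E_def)
      then show ?thesis using H kgraph_finite_edge[OF H, of e] by (auto simp: kgraph_def)
    qed
    \<comment> \<open>The link of v is 3-uniform, so the excess bound applies with k = 3.\<close>
    have "S - real (card E) * l ^ 3 = (\<Sum>e'\<in>(\<lambda>e. e - {v}) ` E. (\<Prod>w\<in>e'. x w) - l ^ 3)"
      by (simp add: sum.reindex[OF inj] sum_subtractf S_def card_image[OF inj])
    also have "\<dots> \<le> (\<Sum>v\<in>verts H. x v) ^ 3 - (m * l) ^ 3"
      unfolding m_def by (rule sum_prod_subsets_diff_le[OF fin mem]) (use l0 xl in auto)
    also have "\<dots> \<le> (m * u) ^ 3 - (m * l) ^ 3"
      using Sx x(1) by (intro diff_right_mono power_mono) (auto intro: sum_nonneg)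
    finally have "S \<le> real (card E) * l ^ 3 + m ^ 3 * (u ^ 3 - l ^ 3)"
      by (simp add: power_mult_distrib algebra_simps)
    also have "\<dots> \<le> real (card E) * u ^ 3 + m ^ 3 * (3 * \<delta> * u ^ 3)"
      using lu l0 l3 m by (intro add_mono mult_left_mono power_mono) (auto simp: algebra_simps)
    finally have upper: "S \<le> (real (card E) + 3 * \<delta> * m ^ 3) * u ^ 3" by (simp add: algebra_simps)
    have xv: "0 < x v" using xl[OF v] l0 by linarith
    have "24 * S = 4 * lambda_spec 4 \<alpha> H * x v powr (\<alpha> - 1)"
      using link_sum_eq_at_maximizer[OF H ne _ _ x v xv] \<alpha>
      by (simp add: link_sum_def S_def E_def fact_numeral)
    then have S: "S = lambda_spec 4 \<alpha> H * x v powr (\<alpha> - 1) / 6" by (simp add: mult_ac)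
    \<comment> \<open>Heaviness is raised to the power 1 - 1/\<alpha>, which turns (x v)^\<alpha>
      into the power \<alpha> - 1 of the Lagrange condition.\<close>
    have "(1 - \<delta>) * m powr - (1 - 1 / \<alpha>) \<le> (1 - \<delta>) powr (1 - 1 / \<alpha>) * m powr - (1 - 1 / \<alpha>)"
      using le1[of "1 - 1 / \<alpha>"] \<alpha> by (intro mult_right_mono) auto
    also have "\<dots> = ((1 - \<delta>) / m) powr (1 - 1 / \<alpha>)"
      using \<delta> m by (simp add: powr_divide powr_minus_divide del: minus_diff_eq)
    also have "\<dots> \<le> (x v powr \<alpha>) powr (1 - 1 / \<alpha>)"
      using heavy[OF v] \<delta> m \<alpha> by (intro powr_mono2) (auto simp: m_def)
    also have "\<dots> = x v powr (\<alpha> - 1)" using \<alpha> by (simp add: powr_powr algebra_simps)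
    finally have xa: "(1 - \<delta>) * m powr - (1 - 1 / \<alpha>) \<le> x v powr (\<alpha> - 1)" .
    have "m powr (4 - 4 / \<alpha>) * m powr - (1 - 1 / \<alpha>) = (m * u) ^ 3"
      using m by (simp add: mu[symmetric] powr_powr algebra_simps flip: powr_add powr_numeral)
    then have "3 / 8 * (1 - \<eta>) * (1 - \<delta>) * (m * u) ^ 3
        = 3 / 8 * (1 - \<eta>) * m powr (4 - 4 / \<alpha>) * ((1 - \<delta>) * m powr - (1 - 1 / \<alpha>))"
      by (metis mult.assoc mult.left_commute)
    also have "\<dots>
        \<le> lambda_spec 4 \<alpha> H * x v powr (\<alpha> - 1)"
    proof (rule mult_mono[OF _ xa])
      show *: "3 / 8 * (1 - \<eta>) * m powr (4 - 4 / \<alpha>) \<le> lambda_spec 4 \<alpha> H" using lam by (simp add: m_def)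
      have "0 \<le> 3 / 8 * (1 - \<eta>) * m powr (4 - 4 / \<alpha>)" using \<eta> by simp
      with * show "0 \<le> lambda_spec 4 \<alpha> H" by (rule order_trans[rotated])
    qed (use \<delta> in auto)
    finally have "3 / 8 * (1 - \<eta>) * (1 - \<delta>) * (m * u) ^ 3 \<le> 6 * S"
      unfolding S by simp
    moreover have "3 / 8 * (1 - \<eta>) * (1 - \<delta>) * (m * u) ^ 3
        = 6 * ((1 - \<eta>) * (1 - \<delta>) / 16 * m ^ 3 * u ^ 3)"
      by (simp add: power_mult_distrib field_simps)
    ultimately have "(1 - \<eta>) * (1 - \<delta>) / 16 * m ^ 3 * u ^ 3 \<le> S" by linarith
    with upper have "(1 - \<eta>) * (1 - \<delta>) / 16 * m ^ 3 * u ^ 3 \<le> (real (card E) + 3 * \<delta> * m ^ 3) * u ^ 3"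
      by linarith
    then have "(1 - \<eta>) * (1 - \<delta>) / 16 * m ^ 3 \<le> real (card E) + 3 * \<delta> * m ^ 3"
      using u by (simp only: mult_le_cancel_right) simp
    then show ?thesis by (simp add: degree_def E_def algebra_simps)
  qed
  have "min_degree H \<in> degree H ` verts H"
    unfolding min_degree_def using fin ne by (intro Min_in) auto
  then show ?thesis using deg by (auto simp: m_def)
qed

section \<open>The Turan density\<close>

text \<open>\<open>turan_ex\<close> is a \<open>Max\<close>, so its set is first shown finite and to
  contain the edge number of \<open>B4 n\<close>. An extremal graph is colorable; with parts of
  sizes a and b, four times its edge number is at most (a b)^2 \<le> (n^2 / 4)^2.\<close>

lemma turan_ex_bounds:
  assumes tp: "turan_pair 4 \<F> pattern22"
  shows "card (edges (B4 n)) \<le> turan_ex 4 \<F> n" "64 * real (turan_ex 4 \<F> n) \<le> real n ^ 4"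
proof -
  define S where "S = {card (edges H) | H :: nat hypergraph. kgraph 4 H \<and> free_of \<F> H \<and> card (verts H) = n}"
  have "S \<subseteq> {..2 ^ n}"
  proof
    fix s assume "s \<in> S"
    then obtain H :: "nat hypergraph" where H: "s = card (edges H)" "kgraph 4 H" "card (verts H) = n"
      by (auto simp: S_def)
    have "edges H \<subseteq> Pow (verts H)" "finite (verts H)" using H(2) by (auto simp: kgraph_def)
    then have "card (edges H) \<le> 2 ^ n"
      using card_mono[of "Pow (verts H)" "edges H"] H(3) by (simp add: card_Pow)
    then show "s \<in> {..2 ^ n}" using H by simp
  qed
  then have fS: "finite S" by (rule finite_subset) simp
  have "free_of \<F> (B4 n)"
    using tp kgraph_B4 colorable_B4 unfolding turan_pair_def by blast
  then have BS: "card (edges (B4 n)) \<in> S"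
    unfolding S_def using kgraph_B4[of n] by (intro CollectI exI[of _ "B4 n"]) (simp add: verts_B4)
  have ex: "turan_ex 4 \<F> n = Max S" by (simp add: turan_ex_def S_def)
  show "card (edges (B4 n)) \<le> turan_ex 4 \<F> n" unfolding ex by (rule Max_ge[OF fS BS])
  have "Max S \<in> S" using fS BS by (intro Max_in) auto
  then obtain H :: "nat hypergraph" where H: "Max S = card (edges H)" "kgraph 4 H" "free_of \<F> H" "card (verts H) = n"
    by (auto simp: S_def)
  then have "colorable pattern22 H" using tp ex unfolding turan_pair_def by metis
  then obtain A B where AB: "A \<inter> B = {}" "A \<union> B = verts H" "edges H \<subseteq> complete22 A B"
    using colorable_pattern22_iff[OF H(2)] by blast
  have fin: "finite A" "finite B" using H(2) AB(2) by (auto simp: kgraph_def intro: finite_subset)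
  have "card A + card B = n" using card_Un_disjoint[OF fin AB(1)] AB(2) H(4) by simp
  then have ab: "card A * card B \<le> balanced_product n" by (rule mult_le_balanced_product)
  define a where "a = real (card A)"
  define b where "b = real (card B)"
  have "0 \<le> b * (b - 1)" by (cases "card B") (auto simp: b_def)
  then have aa: "a * (a - 1) \<le> a * a" "b * (b - 1) \<le> b * b" "0 \<le> b * (b - 1)" "0 \<le> a" "0 \<le> b"
    by (auto simp: a_def b_def mult_left_mono)
  have "4 * real (card (edges H)) \<le> 4 * real (card (complete22 A B))"
    using card_mono[OF finite_complete22[OF fin] AB(3)] by simp
  also have "\<dots> = (a * (a - 1)) * (b * (b - 1))"
    unfolding a_def b_def by (rule card_edges_complete22[OF fin AB(1)])
  also have "\<dots> \<le> (a * a) * (b * b)" by (rule mult_mono) (use aa in auto)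
  also have "\<dots> = (a * b)\<^sup>2" by (simp add: power2_eq_square)
  also have "\<dots> \<le> ((real n)\<^sup>2 / 4)\<^sup>2"
  proof (intro power_mono)
    have "a * b \<le> real (balanced_product n)"
      unfolding a_def b_def of_nat_mult[symmetric] using ab by (rule of_nat_mono)
    then show "a * b \<le> (real n)\<^sup>2 / 4" using balanced_product_bounds(2)[of n] by simp
  qed (use aa in auto)
  also have "\<dots> = real n ^ 4 / 16" by (simp add: power_divide)
  finally show "64 * real (turan_ex 4 \<F> n) \<le> real n ^ 4" by (simp add: ex H(1))
qed

lemma card_edges_B4_ge:
  assumes "n \<ge> 3"
  shows "((real n - 1) * (real n - 3))\<^sup>2 / 64 \<le> real (card (edges (B4 n)))"
proof -
  define a where "a = real (n div 2)"
  define b where "b = real (n - n div 2)"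
  have dj: "{..<n div 2} \<inter> {n div 2..<n} = {}" by auto
  have "(real n - 1) / 2 \<le> a" "(real n - 1) / 2 \<le> b" 
    unfolding a_def b_def by (cases "even n"; auto elim!: evenE oddE)+
  moreover have "(real n - 1) / 2 * ((real n - 3) / 2) \<le> t * (t - 1)" if "(real n - 1) / 2 \<le> t" for t
    using that assms by (intro mult_mono) auto
  ultimately have ab: "(real n - 1) / 2 * ((real n - 3) / 2) \<le> a * (a - 1)"
    "(real n - 1) / 2 * ((real n - 3) / 2) \<le> b * (b - 1)" by blast+
  then have "((real n - 1) / 2 * ((real n - 3) / 2)) * ((real n - 1) / 2 * ((real n - 3) / 2))
      \<le> (a * (a - 1)) * (b * (b - 1))"
    using assms by (intro mult_mono[OF ab] order_trans[OF _ ab(1)] mult_nonneg_nonneg) auto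
  also have "\<dots> = 4 * real (card (edges (B4 n)))"
    using card_edges_complete22[OF _ _ dj] by (simp add: edges_B4 a_def b_def)
  finally show ?thesis by (simp add: power2_eq_square)
qed

text \<open>The extremal number is squeezed to n^4 / 64 asymptotically, against about n^4 / 24 for
  the binomial coefficient.\<close>

lemma turan_density_eq:
  assumes tp: "turan_pair 4 \<F> pattern22"
  shows "turan_density 4 \<F> = 3 / 8"
proof -
  have ch: "real (n choose 4) = real n * (real n - 1) * (real n - 2) * (real n - 3) / 24" if "n \<ge> 4" for n
    using that by (simp add: binomial_gbinomial gbinomial_prod_rev numeral_eq_Suc atLeast0_lessThan_Suc field_simps)
  have "(\<lambda>n. real (turan_ex 4 \<F> n) / real (n choose 4)) \<longlonglongrightarrow> 3 / 8"
  proof (rule tendsto_sandwich)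
    show "eventually (\<lambda>n. ((real n - 1) * (real n - 3))\<^sup>2 / 64 /
        (real n * (real n - 1) * (real n - 2) * (real n - 3) / 24)
        \<le> real (turan_ex 4 \<F> n) / real (n choose 4)) sequentially"
      using eventually_ge_at_top[of 4]
    proof eventually_elim
      case (elim n)
      then have "((real n - 1) * (real n - 3))\<^sup>2 / 64 \<le> real (turan_ex 4 \<F> n)"
        using card_edges_B4_ge[of n] turan_ex_bounds(1)[OF tp, of n] by linarith
      then show ?case unfolding ch[OF elim, symmetric] by (intro divide_right_mono) auto
    qed
    show "eventually (\<lambda>n. real (turan_ex 4 \<F> n) / real (n choose 4)
        \<le> real n ^ 4 / 64 / (real n * (real n - 1) * (real n - 2) * (real n - 3) / 24)) sequentially"
      using eventually_ge_at_top[of 4]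
    proof eventually_elim
      case (elim n)
      have "real (turan_ex 4 \<F> n) \<le> real n ^ 4 / 64"
        using turan_ex_bounds(2)[OF tp, of n] by simp
      then show ?case unfolding ch[OF elim, symmetric] by (intro divide_right_mono) auto
    qed
  qed real_asymp+
  then show ?thesis unfolding turan_density_def by (rule limI)
qed

section \<open>Extremal graphs\<close>

text \<open>The upper bounds for colorable graphs meet the assumed lower bound. Unbalanced parts
  would make one of them strict, and so would a missing edge, since its weight product is
  positive.\<close>

lemma lambda_spec_extremal_colorable:
  assumes G: "kgraph 4 G" and \<alpha>: "\<alpha> > 1" and n: "card (verts G) = n" "n \<ge> 4"
    and x: "\<And>v. v \<in> verts G \<Longrightarrow> 0 < x v" "\<And>v. 0 \<le> x v" "(\<Sum>v\<in>verts G. x v powr \<alpha>) = 1"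
      "lagr 4 G x = lambda_spec 4 \<alpha> G"
    and col: "colorable pattern22 G"
    and ge: "bip_value \<alpha> (real n) (real (balanced_product n)) \<le> lambda_spec 4 \<alpha> G"
  shows "hiso G (B4 n)"
proof -
  have fV: "finite (verts G)" using G by (simp add: kgraph_def)
  have ne: "verts G \<noteq> {}" using n by auto
  obtain A B where AB: "A \<inter> B = {}" "A \<union> B = verts G" "edges G \<subseteq> complete22 A B"
    using col colorable_pattern22_iff[OF G] by blast
  have fin: "finite A" "finite B" using fV AB(2) by (auto intro: finite_subset)
  have cAB: "card A + card B = n" using card_Un_disjoint[OF fin AB(1)] AB(2) n(1) by simp
  have "lambda_spec 4 \<alpha> G \<le> bip_value \<alpha> (real n) (real (card A * card B))"
    using lambda_spec_le_bip_value[OF G ne _ AB] \<alpha> n(1) by simp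
  then have half: "card A = n div 2 \<or> card B = n div 2"
    using bip_value_le_balanced(2)[OF \<alpha> n(2) cAB] ge by linarith
  have E: "edges G = complete22 A B"
  proof (rule ccontr)
    assume "edges G \<noteq> complete22 A B"
    then obtain e where e: "e \<in> complete22 A B" "e \<notin> edges G" using AB(3) by blast
    have "0 < (\<Prod>v\<in>e. x v)"
      using e(1) AB(2) x(1) by (intro prod_pos) (auto simp: complete22_def)
    have "(\<Sum>e\<in>edges G. \<Prod>v\<in>e. x v) < (\<Sum>e\<in>complete22 A B. \<Prod>v\<in>e. x v)"
      using finite_complete22[OF fin] AB(3) e \<open>0 < (\<Prod>v\<in>e. x v)\<close> x(2)
      by (intro sum_strict_mono2[where b = e]) (auto intro: prod_nonneg)
    then have "lambda_spec 4 \<alpha> G < 24 * (\<Sum>e\<in>complete22 A B. \<Prod>v\<in>e. x v)"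
      using x(4) by (simp add: lagr_def fact_numeral)
    also have "\<dots> \<le> bip_value \<alpha> (real n) (real (card A * card B))"
      using sum_prod_complete22_le[OF fin AB(1) x(2)] \<alpha> x(3) AB(2) n(1) by simp
    also have "\<dots> \<le> bip_value \<alpha> (real n) (real (balanced_product n))"
      by (rule bip_value_le_balanced(1)[OF \<alpha> n(2) cAB])
    finally show False using ge by simp
  qed
  from half show ?thesis
  proof
    assume "card A = n div 2"
    moreover from this have "card B = n - n div 2" using cAB by simp
    ultimately show ?thesis by (rule hiso_B4I[OF fin AB(1) AB(2)[symmetric] E])
  next
    assume cB: "card B = n div 2"
    have "complete22 A B = complete22 B A" by (auto simp: complete22_def)
    with cB cAB show ?thesis
      using fin AB E by (intro hiso_B4I[of B A]) auto
  qed
qed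

theorem theorem3p6:
  fixes \<F> :: "nat hypergraph set" and \<alpha> :: real
  assumes "\<forall>F\<in>\<F>. kgraph 4 F"
    and "turan_pair 4 \<F> pattern22"
    and "degree_stable 4 \<F> (Col 4 pattern22)"
    and "\<alpha> > 1"
  shows "\<exists>n\<^sub>0. \<forall>n>n\<^sub>0. \<forall>G :: nat hypergraph.
           kgraph 4 G \<and> free_of \<F> G \<and> card (verts G) = n \<longrightarrow>
             lambda_spec 4 \<alpha> G \<le> lambda_spec 4 \<alpha> (B4 n) \<and>
             (lambda_spec 4 \<alpha> G = lambda_spec 4 \<alpha> (B4 n) \<longleftrightarrow> hiso G (B4 n))"
proof -
  note \<alpha> = \<open>\<alpha> > 1\<close>
  define \<beta> where "\<beta> n = bip_value \<alpha> (real n) (real (balanced_product n))" for n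
  have "\<exists>\<epsilon>>0. \<exists>N. \<forall>n\<ge>N. \<forall>H :: nat hypergraph. kgraph 4 H \<and> free_of \<F> H \<and> card (verts H) = n \<and>
      (3 / 8 / fact (4 - 1) - \<epsilon>) * real n ^ (4 - 1) \<le> real (min_degree H) \<longrightarrow> H \<in> Col 4 pattern22"
    using assms(3) unfolding degree_stable_def turan_density_eq[OF assms(2)] by blast
  moreover have "3 / 8 / fact (4 - 1) = (1 / 16 :: real)" "4 - 1 = (3 :: nat)"
    by (simp_all add: fact_numeral)
  ultimately obtain \<epsilon> N\<^sub>0 where \<epsilon>: "\<epsilon> > 0" and stable: "\<And>H :: nat hypergraph. kgraph 4 H \<Longrightarrow> free_of \<F> H \<Longrightarrow>
      N\<^sub>0 \<le> card (verts H) \<Longrightarrow> (1 / 16 - \<epsilon>) * real (card (verts H)) ^ 3 \<le> real (min_degree H) \<Longrightarrow>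
      H \<in> Col 4 pattern22"
    by metis
  \<comment> \<open>Capping at 1 keeps 1 - \<eta> nonnegative. With \<delta> = \<eta>/4 the total
    loss is at most (\<eta> + \<delta>)/16 + 3 \<delta> = 53 \<eta> / 64, which is below
    \<epsilon>.\<close>
  define \<eta> where "\<eta> = min \<epsilon> 1"
  define \<delta> where "\<delta> = \<eta> / 4"
  have \<eta>: "0 < \<eta>" "\<eta> \<le> 1" "\<eta> \<le> \<epsilon>" using \<epsilon> by (auto simp: \<eta>_def)
  have \<delta>: "0 < \<delta>" "\<delta> < 1" using \<eta> by (auto simp: \<delta>_def)
  have "(1 - \<eta>) * (1 - \<delta>) \<ge> 1 - \<eta> - \<delta>" using \<eta> \<delta> by (simp add: algebra_simps)
  then have \<epsilon>16: "1 / 16 - \<epsilon> \<le> (1 - \<eta>) * (1 - \<delta>) / 16 - 3 * \<delta>" using \<eta> unfolding \<delta>_def by linarith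
  define \<tau> where "\<tau> = 4 / \<alpha>"
  have \<tau>: "0 < \<tau>" "\<tau> < 4" using \<alpha> by (auto simp: \<tau>_def field_simps)
  \<comment> \<open>The gap between s and the true growth exponent 4 - \<tau>: positive, so that
    scaled values still grow, and small enough for the deletion estimate.\<close>
  define c where "c = (4 - \<tau>) * \<delta> / 2"
  define s where "s = 4 - \<tau> - c"
  have c: "0 < c" using \<tau> \<delta> by (simp add: c_def)
  obtain M\<^sub>1 where M1: "4 \<le> M\<^sub>1" "\<And>m n. M\<^sub>1 \<le> m \<Longrightarrow> m < n \<Longrightarrow> \<beta> m * real m powr - s < \<beta> n * real n powr - s"
    using bip_value_scaled_strict_mono[OF \<alpha> c] unfolding \<beta>_def s_def \<tau>_def by blast
  obtain M\<^sub>2 where M2: "\<And>n. M\<^sub>2 \<le> n \<Longrightarrow> 3 / 8 * (1 - \<eta>) * real n powr (4 - 4 / \<alpha>) \<le> \<beta> n"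
    using bip_value_balanced_asymp_lower[OF \<alpha> \<eta>(1)] unfolding \<beta>_def eventually_sequentially by blast
  obtain M\<^sub>3 where M3: "\<And>m t. M\<^sub>3 \<le> m \<Longrightarrow> 0 \<le> t \<Longrightarrow> t \<le> (1 - \<delta>) / real m \<Longrightarrow>
      (1 - t) powr \<tau> * (1 - 1 / real m) powr s < 1 - 4 * t"
    using deletion_factor_less[OF \<tau> \<delta>] unfolding s_def c_def by blast
  define M where "M = Max {N\<^sub>0, M\<^sub>1, M\<^sub>2, M\<^sub>3}"
  have M: "N\<^sub>0 \<le> M" "M\<^sub>1 \<le> M" "M\<^sub>2 \<le> M" "M\<^sub>3 \<le> M" by (auto simp: M_def)
  \<comment> \<open>The fixed loss 1/2 gives the constant 3/16, enough to compare with the crude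
    bound 24 m^(4 - 4/\<alpha>) when showing that \<open>W\<close> is large.\<close>
  have "eventually (\<lambda>n. 3 / 8 * (1 - 1 / 2) * real n powr (4 - 4 / \<alpha>) \<le> \<beta> n) sequentially"
    unfolding \<beta>_def by (rule bip_value_balanced_asymp_lower[OF \<alpha>]) simp
  moreover have "eventually (\<lambda>n. 24 * real M powr c < 3 / 16 * real n powr c) sequentially"
    using c by real_asymp
  ultimately have "eventually (\<lambda>n. 3 / 8 * (1 - 1 / 2) * real n powr (4 - 4 / \<alpha>) \<le> \<beta> n \<and>
      24 * real M powr c < 3 / 16 * real n powr c) sequentially" by (rule eventually_conj)
  then obtain N where N: "\<And>n. n \<ge> N \<Longrightarrow> 3 / 16 * real n powr (4 - 4 / \<alpha>) \<le> \<beta> n"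
      "\<And>n. n \<ge> N \<Longrightarrow> 24 * real M powr c < 3 / 16 * real n powr c"
    by (auto simp: eventually_sequentially)
  have iso: "hiso G (B4 n)"
    if n: "n > max N M" and G: "kgraph 4 G" "free_of \<F> G" "card (verts G) = n" and ge: "\<beta> n \<le> lambda_spec 4 \<alpha> G"
    for n and G :: "nat hypergraph"
  proof -
    have n4: "4 \<le> n" "N \<le> n" "M \<le> n" using n M M1(1) by auto
    have fV: "finite (verts G)" using G by (simp add: kgraph_def)
    have Vne: "verts G \<noteq> {}" using G n4 by auto
    define f where "f W = lambda_spec 4 \<alpha> (induced G W) * real (card W) powr - s" for W
    define \<W> where "\<W> = Pow (verts G) - {{}}"
    have "finite \<W>" "verts G \<in> \<W>" using fV Vne by (auto simp: \<W>_def)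
    then have "Max (f ` \<W>) \<in> f ` \<W>" by (intro Max_in) auto
    then obtain W where W: "W \<in> \<W>" "f W = Max (f ` \<W>)" by auto
    have fmax: "f U \<le> f W" if "U \<in> \<W>" for U
      unfolding W(2) using that \<open>finite \<W>\<close> by (intro Max_ge) auto
    define H where "H = induced G W"
    define m where "m = card W"
    have WV: "W \<subseteq> verts G" "W \<noteq> {}" using W(1) by (auto simp: \<W>_def)
    have fW: "finite W" using WV fV finite_subset by blast
    have m0: "0 < m" using fW WV by (simp add: m_def card_gt_0_iff)
    have H: "kgraph 4 H" "free_of \<F> H" "verts H = W"
      using G WV by (auto simp: H_def intro: kgraph_induced free_of_induced)
    have fH: "f W = lambda_spec 4 \<alpha> H * real m powr - s" by (simp add: f_def H_def m_def)
    have fn: "\<beta> n * real n powr - s \<le> f W"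
    proof -
      have "\<beta> n * real n powr - s \<le> f (verts G)"
        unfolding f_def induced_verts[OF G(1)] G(3) using ge by (intro mult_right_mono) auto
      then show ?thesis using fmax[OF \<open>verts G \<in> \<W>\<close>] by linarith
    qed
    \<comment> \<open>Otherwise \<open>f W\<close> is at most 24 M^c, whereas \<open>verts G\<close>
      already gives at least 3/16 n^c.\<close>
    have "M \<le> m"
    proof (rule ccontr)
      assume "\<not> M \<le> m"
      have "real k powr (4 - 4 / \<alpha>) * real k powr - s = real k powr c" for k
        by (simp add: s_def \<tau>_def flip: powr_add)
      note pw = this
      have "3 / 16 * real n powr c = 3 / 16 * real n powr (4 - 4 / \<alpha>) * real n powr - s"
        by (simp only: mult.assoc pw)
      also have "\<dots> \<le> \<beta> n * real n powr - s" using N(1)[OF n4(2)] by (intro mult_right_mono) auto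
      also have "\<dots> \<le> lambda_spec 4 \<alpha> H * real m powr - s" using fn fH by simp
      also have "\<dots> \<le> 24 * real m powr (4 - 4 / \<alpha>) * real m powr - s"
        using lambda_spec_le_powr[OF H(1), of \<alpha>] H(3) WV \<alpha>
        by (intro mult_right_mono) (auto simp: m_def fact_numeral)
      also have "\<dots> = 24 * real m powr c" by (simp only: mult.assoc pw)
      also have "\<dots> \<le> 24 * real M powr c"
        using \<open>\<not> M \<le> m\<close> c by (intro mult_left_mono powr_mono2) auto
      finally show False using N(2)[OF n4(2)] by simp
    qed
    have m4: "4 \<le> m" using \<open>M \<le> m\<close> M M1(1) by linarith
    have mn: "m \<le> n" using card_mono[OF fV WV(1)] G(3) by (simp add: m_def)
    \<comment> \<open>Monotonicity carries the lower bound over from \<open>G\<close>: scaled by the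
      power -s, \<open>H\<close> beats the value for n, hence the one for m.\<close>
    have "\<beta> m * real m powr - s \<le> \<beta> n * real n powr - s"
      using M1(2)[of m n] mn M \<open>M \<le> m\<close> by (cases "m = n") auto
    then have "\<beta> m * real m powr - s \<le> lambda_spec 4 \<alpha> H * real m powr - s" using fn fH by linarith
    then have lam: "\<beta> m \<le> lambda_spec 4 \<alpha> H" using m0 by simp
    have "0 < lambda_spec 4 \<alpha> H * real m powr - s"
    proof -
      have "0 < 3 / 16 * real n powr (4 - 4 / \<alpha>)" using n4 by simp
      then have "0 < \<beta> n" using N(1)[OF n4(2)] by linarith
      then have "0 < \<beta> n * real n powr - s" using n4 by simp
      then show ?thesis using fn fH by linarith
    qed
    then have lam0: "0 < lambda_spec 4 \<alpha> H" using m0 by (simp add: zero_less_mult_iff)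
    have vne: "verts H \<noteq> {}" using H WV by simp
    obtain x where x: "\<And>v. 0 \<le> x v" "(\<Sum>v\<in>verts H. x v powr \<alpha>) = 1" "lagr 4 H x = lambda_spec 4 \<alpha> H"
      using lambda_spec_attained_nonneg[OF H(1) vne, of \<alpha>] \<alpha> by auto
    \<comment> \<open>Deleting a lighter vertex would raise \<open>f\<close>: maximality of
      \<open>W\<close> bounds the new value by the old one times (1 - 1/m)^s, which contradicts the
      deletion lemma.\<close>
    have heavy: "(1 - \<delta>) / real m \<le> x v powr \<alpha>" if v: "v \<in> verts H" for v
    proof (rule ccontr)
      assume "\<not> (1 - \<delta>) / real m \<le> x v powr \<alpha>"
      define t where "t = x v powr \<alpha>"
      have t: "0 \<le> t" "t \<le> (1 - \<delta>) / real m"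
        using \<open>\<not> (1 - \<delta>) / real m \<le> x v powr \<alpha>\<close> by (auto simp: t_def)
      have cU: "card (W - {v}) = m - 1" using v H fW by (simp add: m_def)
      then have "card (W - {v}) \<noteq> 0" using m4 by simp
      then have Une: "W - {v} \<noteq> {}" by force
      have "W - {v} \<in> \<W>" using Une WV by (auto simp: \<W>_def)
      define lam' where "lam' = lambda_spec 4 \<alpha> (induced G (W - {v}))"
      have "lam' * real (m - 1) powr - s \<le> lambda_spec 4 \<alpha> H * real m powr - s"
        using fmax[OF \<open>W - {v} \<in> \<W>\<close>] unfolding fH by (simp add: f_def cU lam'_def)
      then have "lam' \<le> lambda_spec 4 \<alpha> H * (real m powr - s * real (m - 1) powr s)"
        using m4 by (simp add: powr_minus field_simps)
      also have "real m powr - s * real (m - 1) powr s = (1 - 1 / real m) powr s"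
        using m4 by (simp add: powr_minus_divide of_nat_diff diff_divide_distrib flip: powr_divide)
      finally have le: "lam' \<le> lambda_spec 4 \<alpha> H * (1 - 1 / real m) powr s" .
      have "lambda_spec 4 \<alpha> H * (1 - 4 * t) \<le> lam' * (1 - t) powr \<tau>"
        using lambda_spec_delete_vertex[OF H(1) _ _ x v] Une \<alpha> H(3)
        by (simp add: t_def lam'_def \<tau>_def H_def induced_induced)
      also have "\<dots> \<le> lambda_spec 4 \<alpha> H * (1 - 1 / real m) powr s * (1 - t) powr \<tau>"
        using le by (intro mult_right_mono) auto
      also have "\<dots> = lambda_spec 4 \<alpha> H * ((1 - t) powr \<tau> * (1 - 1 / real m) powr s)" by simp
      also have "\<dots> < lambda_spec 4 \<alpha> H * (1 - 4 * t)"
        using M3[of m t] M \<open>M \<le> m\<close> t lam0 by (intro mult_strict_left_mono) auto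
      finally show False by simp
    qed
    have "(1 / 16 - \<epsilon>) * real m ^ 3 \<le> ((1 - \<eta>) * (1 - \<delta>) / 16 - 3 * \<delta>) * real m ^ 3"
      using \<epsilon>16 by (intro mult_right_mono) auto
    also have "\<dots> \<le> real (min_degree H)"
    proof -
      have cH: "card (verts H) = m" using H(3) by (simp add: m_def)
      have "3 / 8 * (1 - \<eta>) * real m powr (4 - 4 / \<alpha>) \<le> lambda_spec 4 \<alpha> H"
        using M2[of m] M \<open>M \<le> m\<close> lam by linarith
      then show ?thesis
        using min_degree_ge_of_heavy_vertices[OF H(1) vne \<alpha> x, of \<delta> \<eta>] heavy \<delta> \<eta> unfolding cH by simp
    qed
    finally have "H \<in> Col 4 pattern22"
      using stable[OF H(1,2)] M \<open>M \<le> m\<close> H(3) by (simp add: m_def)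
    then have col: "colorable pattern22 H" by (simp add: Col_def)
    have "lambda_spec 4 \<alpha> H \<le> \<beta> m"
    proof -
      obtain A B where AB: "A \<inter> B = {}" "A \<union> B = verts H" "edges H \<subseteq> complete22 A B"
        using col colorable_pattern22_iff[OF H(1)] by blast
      have fin: "finite A" "finite B" using fW AB(2) H(3) by (auto intro: finite_subset)
      have "card A + card B = m" using card_Un_disjoint[OF fin AB(1)] AB(2) H(3) by (simp add: m_def)
      from bip_value_le_balanced(1)[OF \<alpha> m4 this] show ?thesis
        using lambda_spec_le_bip_value[OF H(1) vne less_imp_le[OF \<alpha>] AB] H(3) by (simp add: \<beta>_def m_def)
    qed
    then have "f W \<le> \<beta> m * real m powr - s" unfolding fH by (intro mult_right_mono) auto
    \<comment> \<open>For m < n the chain \<open>f W\<close> \<le> \<beta>(m) m^(-s) < \<beta>(n)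
      n^(-s) \<le> \<open>f W\<close> would be contradictory.\<close>
    then have "m = n"
      using M1(2)[of m n] mn M \<open>M \<le> m\<close> fn by (cases "m = n") auto
    then have "W = verts G" using card_subset_eq[OF fV WV(1)] G(3) by (simp add: m_def)
    then have HG: "H = G" using induced_verts[OF G(1)] by (simp add: H_def)
    have "0 < x v" if "v \<in> verts G" for v
    proof -
      have "0 < (1 - \<delta>) / real m" using \<delta> m0 by simp
      also have "\<dots> \<le> x v powr \<alpha>" using heavy[of v] that HG by blast
      finally have "0 < x v powr \<alpha>" .
      then show ?thesis using x(1)[of v] by (cases "x v = 0") auto
    qed
    then show ?thesis
      using lambda_spec_extremal_colorable[OF G(1) \<alpha> G(3) n4(1), of x] x col ge
      unfolding HG \<beta>_def by blast
  qed
  show ?thesis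
  proof (intro exI[of _ "max N M"] allI impI)
    fix n and G :: "nat hypergraph"
    assume n: "n > max N M" and "kgraph 4 G \<and> free_of \<F> G \<and> card (verts G) = n"
    then have G: "kgraph 4 G" "free_of \<F> G" "card (verts G) = n" by auto
    have "2 \<le> n" using n M M1(1) by linarith
    then have B: "lambda_spec 4 \<alpha> (B4 n) = \<beta> n" using lambda_spec_B4[of \<alpha> n] \<alpha> by (simp add: \<beta>_def)
    \<comment> \<open>This settles the inequality as well: a value above that of \<open>B4 n\<close>
      would give an isomorphism, and isomorphic graphs have equal values.\<close>
    have "hiso G (B4 n)" if "lambda_spec 4 \<alpha> (B4 n) \<le> lambda_spec 4 \<alpha> G"
      using iso[OF n G] that B by simp
    moreover have "lambda_spec 4 \<alpha> G = lambda_spec 4 \<alpha> (B4 n)" if "hiso G (B4 n)"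
      by (rule lambda_spec_hiso[OF kgraph_B4 that G(1)])
    ultimately show "lambda_spec 4 \<alpha> G \<le> lambda_spec 4 \<alpha> (B4 n) \<and>
        (lambda_spec 4 \<alpha> G = lambda_spec 4 \<alpha> (B4 n) \<longleftrightarrow> hiso G (B4 n))"
      by (metis linear order_refl)
  qed
qed

end
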